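(* Suppose that $1/2<d(s)<1$ for all $s\in\mathbb S$ and that the integrals $$\int_{\mathbb S}\frac{\sigma^2(v)}{[1-d(v)]^2}\,\mu(\mathrm dv)\quad\text{and}\quad\int_{\mathbb S}\frac{\sigma^2(v)}{[1-d(v)][2d(v)-1]}\,\mu(\mathrm dv)$$ are finite. Then the $L_2(\mu)$-valued stochastic process $\{\mathcal X(\cdot,t):t\in[0,\infty)\}$ is operator self-similar with scaling family of operators $\{a^H:a>0\}$, where $a^H$, $a>0$, is the multiplication operator defined by $a^Hf=\{a^{3/2-d(s)}f(s):s\in\mathbb S\}$ for $f\in L_2(\mu)$.
   Context: $(\mathbb S,\mathcal S,\mu)$ is a $\sigma$-finite measure space such that the real Hilbert space $L_2(\mu)=L_2(\mathbb S,\mathcal S,\mu)$ is separable. $d:\mathbb S\to\mathbb R$ is a measurable function. $\varepsilon_0=\{\varepsilon_0(s):s\in\mathbb S\}$ is a measurable stochastic process (jointly measurable on $\Omega\times\mathbb S$) with $\operatorname E\varepsilon_0(s)=0$ and $\operatorname E\varepsilon_0^2(s)<\infty$ for each $s\in\mathbb S$; $\sigma(r,s)=\operatorname E[\varepsilon_0(r)\varepsilon_0(s)]$, $\sigma^2(s)=\operatorname E\varepsilon_0^2(s)$. Put $d(r,s)=d(r)+d(s)$, $c(r,s)=\int_0^\infty x^{-d(r)}(x+1)^{-d(s)}\,\mathrm dx$, and $C(r,s;t)=c(r,s)$ if $t<0$, $C(r,s;t)=c(s,r)$ if $t>0$. For $(r,t),(s,u)\in\mathbb S\times[0,\infty)$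 define $$V((r,t),(s,u))=\frac{\sigma(r,s)}{[2-d(r,s)][3-d(r,s)]}\bigl[c(s,r)t^{3-d(r,s)}+c(r,s)u^{3-d(r,s)}-C(r,s;t-u)|t-u|^{3-d(r,s)}\bigr],$$ the last term being $0$ when $t=u$. $\mathcal X=\{\mathcal X(s,t):(s,t)\in\mathbb S\times[0,\infty)\}$ is a zero-mean Gaussian process with covariance function $V$, such that for each $t$ the map $(\omega,s)\mapsto\mathcal X(s,t)(\omega)$ is jointly measurable; under the stated integrability conditions its sample paths $s\mapsto\mathcal X(s,t)$ are almost surely square $\mu$-integrable for each $t$, and $\mathcal X(\cdot,t)$ denotes the induced random element of $L_2(\mu)$. A stochastic process $\{\xi(t):t\ge0\}$ with values in a Banach space $\mathbb E$ is operator self-similar with scaling family $\{T(a):a>0\}$, where each $T(a)$ is a bounded linear operator on $\mathbb E$, if for each $a>0$ the processes $\{\xi(at):t\ge0\}$ and $\{T(a)\xi(t):t\ge0\}$ have the same finite-dimensional distributions. *)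

theory Defs
  imports "HOL-Probability.Probability"
begin

section \<open>The space $L_2(\mu)$\<close>

text \<open>
  The elements of \<open>l2_space M\<close> are equivalence classes of square integrable functions modulo
  equality almost everywhere. Operations are computed on a representative; the result does not
  depend on the choice of the latter.
\<close>

definition l2_funs :: "'s measure \<Rightarrow> ('s \<Rightarrow> real) set" where
  "l2_funs M = {f \<in> borel_measurable M. integrable M (\<lambda>s. (f s)\<^sup>2)}"

definition l2_rel :: "'s measure \<Rightarrow> (('s \<Rightarrow> real) \<times> ('s \<Rightarrow> real)) set" where
  "l2_rel M = {(f, g). f \<in> l2_funs M \<and> g \<in> l2_funs M \<and> (AE s in M. f s = g s)}"

definition l2_space :: "'s measure \<Rightarrow> ('s \<Rightarrow> real) set set" where
  "l2_space M = l2_funs M // l2_rel M"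

definition l2_class :: "'s measure \<Rightarrow> ('s \<Rightarrow> real) \<Rightarrow> ('s \<Rightarrow> real) set" where
  "l2_class M f = l2_rel M `` {f}"

definition l2_rep :: "('s \<Rightarrow> real) set \<Rightarrow> 's \<Rightarrow> real" where
  "l2_rep F = (SOME f. f \<in> F)"

definition l2_norm :: "'s measure \<Rightarrow> ('s \<Rightarrow> real) set \<Rightarrow> real" where
  "l2_norm M F = sqrt (\<integral>s. (l2_rep F s)\<^sup>2 \<partial>M)"

definition l2_add :: "'s measure \<Rightarrow> ('s \<Rightarrow> real) set \<Rightarrow> ('s \<Rightarrow> real) set \<Rightarrow> ('s \<Rightarrow> real) set" where
  "l2_add M F G = l2_class M (\<lambda>s. l2_rep F s + l2_rep G s)"

definition l2_scale :: "'s measure \<Rightarrow> real \<Rightarrow> ('s \<Rightarrow> real) set \<Rightarrow> ('s \<Rightarrow> real) set" where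
  "l2_scale M k F = l2_class M (\<lambda>s. k * l2_rep F s)"

definition l2_dist :: "'s measure \<Rightarrow> ('s \<Rightarrow> real) set \<Rightarrow> ('s \<Rightarrow> real) set \<Rightarrow> real" where
  "l2_dist M F G = sqrt (\<integral>s. (l2_rep F s - l2_rep G s)\<^sup>2 \<partial>M)"

definition l2_topology :: "'s measure \<Rightarrow> ('s \<Rightarrow> real) set topology" where
  "l2_topology M = Metric_space.mtopology (l2_space M) (l2_dist M)"

definition l2_borel :: "'s measure \<Rightarrow> ('s \<Rightarrow> real) set measure" where
  "l2_borel M = sigma (l2_space M) {U. openin (l2_topology M) U}"

definition l2_bounded_linear ::
    "'s measure \<Rightarrow> (('s \<Rightarrow> real) set \<Rightarrow> ('s \<Rightarrow> real) set) \<Rightarrow> bool" where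
  "l2_bounded_linear M T \<longleftrightarrow>
     (\<forall>F\<in>l2_space M. T F \<in> l2_space M) \<and>
     (\<forall>F\<in>l2_space M. \<forall>G\<in>l2_space M. T (l2_add M F G) = l2_add M (T F) (T G)) \<and>
     (\<forall>k. \<forall>F\<in>l2_space M. T (l2_scale M k F) = l2_scale M k (T F)) \<and>
     (\<exists>K. \<forall>F\<in>l2_space M. l2_norm M (T F) \<le> K * l2_norm M F)"

definition l2_mult_op :: "'s measure \<Rightarrow> ('s \<Rightarrow> real) \<Rightarrow> ('s \<Rightarrow> real) set \<Rightarrow> ('s \<Rightarrow> real) set" where
  "l2_mult_op M h F = l2_class M (\<lambda>s. h s * l2_rep F s)"


section \<open>Stochastic processes\<close>

text \<open>Degenerate normal laws (point masses) are admitted.\<close>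

definition gaussian_rv :: "'w measure \<Rightarrow> ('w \<Rightarrow> real) \<Rightarrow> bool" where
  "gaussian_rv P Y \<longleftrightarrow> Y \<in> borel_measurable P \<and>
     ((\<exists>m. distr P borel Y = return borel m) \<or>
      (\<exists>m v. 0 < v \<and> distributed P lborel Y (normal_density m v)))"

definition gaussian_process :: "'w measure \<Rightarrow> 'i set \<Rightarrow> ('i \<Rightarrow> 'w \<Rightarrow> real) \<Rightarrow> bool" where
  "gaussian_process P I Z \<longleftrightarrow>
     (\<forall>J k. finite J \<and> J \<subseteq> I \<longrightarrow> gaussian_rv P (\<lambda>\<omega>. \<Sum>i\<in>J. k i * Z i \<omega>))"

definition same_fdd ::
    "'w measure \<Rightarrow> 'e measure \<Rightarrow> 'i set \<Rightarrow> ('i \<Rightarrow> 'w \<Rightarrow> 'e) \<Rightarrow> ('i \<Rightarrow> 'w \<Rightarrow> 'e) \<Rightarrow> bool" where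
  "same_fdd P N I \<xi> \<eta> \<longleftrightarrow>
     (\<forall>J. finite J \<and> J \<subseteq> I \<longrightarrow>
        distr P (\<Pi>\<^sub>M j\<in>J. N) (\<lambda>\<omega>. \<lambda>j\<in>J. \<xi> j \<omega>) = distr P (\<Pi>\<^sub>M j\<in>J. N) (\<lambda>\<omega>. \<lambda>j\<in>J. \<eta> j \<omega>))"

text \<open>
  Operator self-similarity for the Banach space $L_2(\mu)$. As \<open>distr\<close> is meaningful for measurable
  functions only, it is required explicitly that every \<open>\<xi> t\<close> is a random element.
\<close>

definition l2_operator_self_similar ::
    "'w measure \<Rightarrow> 's measure \<Rightarrow> (real \<Rightarrow> 'w \<Rightarrow> ('s \<Rightarrow> real) set) \<Rightarrow>
     (real \<Rightarrow> ('s \<Rightarrow> real) set \<Rightarrow> ('s \<Rightarrow> real) set) \<Rightarrow> bool" where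
  "l2_operator_self_similar P M \<xi> T \<longleftrightarrow>
     (\<forall>t\<ge>0. \<xi> t \<in> measurable P (l2_borel M)) \<and>
     (\<forall>a>0. l2_bounded_linear M (T a)) \<and>
     (\<forall>a>0. same_fdd P (l2_borel M) {0..} (\<lambda>t. \<xi> (a * t)) (\<lambda>t \<omega>. T a (\<xi> t \<omega>)))"

text \<open>
  The element of $L_2(\mu)$ induced by a random function with almost surely square integrable
  paths; on the exceptional null event it is set to zero.
\<close>

definition l2_induced :: "'s measure \<Rightarrow> ('s \<Rightarrow> 'w \<Rightarrow> real) \<Rightarrow> 'w \<Rightarrow> ('s \<Rightarrow> real) set" where
  "l2_induced M Y \<omega> =
     (if (\<lambda>s. Y s \<omega>) \<in> l2_funs M then l2_class M (\<lambda>s. Y s \<omega>) else l2_class M (\<lambda>_. 0))"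


section \<open>The covariance function of the limit process\<close>

definition second_moment :: "'w measure \<Rightarrow> ('s \<Rightarrow> 'w \<Rightarrow> real) \<Rightarrow> 's \<Rightarrow> 's \<Rightarrow> real" where
  "second_moment P Y r s = (\<integral>\<omega>. Y r \<omega> * Y s \<omega> \<partial>P)"

definition c_int :: "('s \<Rightarrow> real) \<Rightarrow> 's \<Rightarrow> 's \<Rightarrow> real" where
  "c_int d r s = (LBINT x:{0<..}. x powr (- d r) * (x + 1) powr (- d s))"

text \<open>The value at \<open>t = 0\<close> is immaterial: in \<open>V_cov\<close> it is multiplied by \<open>0\<close>.\<close>

definition C_sgn :: "('s \<Rightarrow> real) \<Rightarrow> 's \<Rightarrow> 's \<Rightarrow> real \<Rightarrow> real" where
  "C_sgn d r s t = (if t < 0 then c_int d r s else if t > 0 then c_int d s r else 0)"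

definition V_cov ::
    "('s \<Rightarrow> real) \<Rightarrow> ('s \<Rightarrow> 's \<Rightarrow> real) \<Rightarrow> 's \<times> real \<Rightarrow> 's \<times> real \<Rightarrow> real" where
  "V_cov d \<sigma> = (\<lambda>(r, t) (s, u).
     \<sigma> r s / ((2 - (d r + d s)) * (3 - (d r + d s))) *
       (c_int d s r * t powr (3 - (d r + d s)) + c_int d r s * u powr (3 - (d r + d s))
        - C_sgn d r s (t - u) * \<bar>t - u\<bar> powr (3 - (d r + d s))))"


section \<open>Consistency of the construction\<close>

lemma equiv_l2_rel: "equiv (l2_funs M) (l2_rel M)"
proof (rule equivI)
  show "l2_rel M \<subseteq> l2_funs M \<times> l2_funs M"
    by (auto simp: l2_rel_def)
  show "refl_on (l2_funs M) (l2_rel M)"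
    by (auto simp: refl_on_def l2_rel_def)
  show "sym (l2_rel M)"
    by (auto simp: sym_def l2_rel_def eq_commute)
  show "trans (l2_rel M)"
    unfolding trans_def l2_rel_def by auto
qed

lemma l2_rep_in:
  assumes "F \<in> l2_space M"
  shows "l2_rep F \<in> F" "l2_rep F \<in> l2_funs M" "l2_class M (l2_rep F) = F"
proof -
  have eq: "equiv (l2_funs M) (l2_rel M)" by (rule equiv_l2_rel)
  have "F \<noteq> {}"
    using in_quotient_imp_non_empty[OF eq] assms by (simp add: l2_space_def)
  then show 1: "l2_rep F \<in> F"
    unfolding l2_rep_def by (simp add: some_in_eq)
  then show "l2_rep F \<in> l2_funs M"
    using in_quotient_imp_subset[OF eq] assms by (auto simp: l2_space_def)
  show "l2_class M (l2_rep F) = F"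
    using assms 1 eq unfolding l2_space_def l2_class_def
    by (metis Image_singleton_iff equiv_class_eq quotientE)
qed

lemma l2_class_in: "f \<in> l2_funs M \<Longrightarrow> l2_class M f \<in> l2_space M"
  by (auto simp: l2_class_def l2_space_def quotientI)

lemma l2_class_eq_iff:
  assumes "f \<in> l2_funs M" "g \<in> l2_funs M"
  shows "l2_class M f = l2_class M g \<longleftrightarrow> (AE s in M. f s = g s)"
  using eq_equiv_class_iff[OF equiv_l2_rel assms] assms
  by (simp add: l2_class_def l2_rel_def)

lemma l2_rep_class_AE:
  assumes "f \<in> l2_funs M"
  shows "AE s in M. l2_rep (l2_class M f) s = f s"
  using l2_rep_in[OF l2_class_in[OF assms]] l2_class_eq_iff assms by metis

lemma l2_norm_class:
  assumes "f \<in> l2_funs M"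
  shows "l2_norm M (l2_class M f) = sqrt (\<integral>s. (f s)\<^sup>2 \<partial>M)"
proof -
  have m: "f \<in> borel_measurable M" "l2_rep (l2_class M f) \<in> borel_measurable M"
    using assms l2_rep_in(2)[OF l2_class_in[OF assms]] by (auto simp: l2_funs_def)
  show ?thesis
    unfolding l2_norm_def
    using l2_rep_class_AE[OF assms] m by (auto intro!: arg_cong[of _ _ sqrt] integral_cong_AE)
qed

lemma l2_funs_mult_integrable:
  assumes "f \<in> l2_funs M" "g \<in> l2_funs M"
  shows "integrable M (\<lambda>s. f s * g s)"
proof (rule Bochner_Integration.integrable_bound)
  show "integrable M (\<lambda>s. (f s)\<^sup>2 + (g s)\<^sup>2)"
    using assms by (auto simp: l2_funs_def)
  show "(\<lambda>s. f s * g s) \<in> borel_measurable M"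
    using assms by (auto simp: l2_funs_def)
  have "\<bar>x * y\<bar> \<le> x\<^sup>2 + y\<^sup>2" for x y :: real
  proof -
    have "2 * (\<bar>x\<bar> * \<bar>y\<bar>) \<le> x\<^sup>2 + y\<^sup>2"
      using sum_squares_bound[of "\<bar>x\<bar>" "\<bar>y\<bar>"] by (simp add: mult.assoc)
    moreover have "0 \<le> \<bar>x\<bar> * \<bar>y\<bar>" by simp
    ultimately show ?thesis unfolding abs_mult by linarith
  qed
  then show "AE s in M. norm (f s * g s) \<le> norm ((f s)\<^sup>2 + (g s)\<^sup>2)"
    by auto
qed

lemma l2_funs_scale: "f \<in> l2_funs M \<Longrightarrow> (\<lambda>s. k * f s) \<in> l2_funs M"
  by (auto simp: l2_funs_def power_mult_distrib)

lemma l2_funs_add: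
  assumes "f \<in> l2_funs M" "g \<in> l2_funs M"
  shows "(\<lambda>s. f s + g s) \<in> l2_funs M"
  using assms l2_funs_mult_integrable[OF assms]
  by (auto simp: l2_funs_def power2_sum mult.assoc)

lemma l2_dist_eq_norm:
  assumes "F \<in> l2_space M" "G \<in> l2_space M"
  shows "l2_dist M F G = l2_norm M (l2_add M F (l2_scale M (-1) G))"
proof -
  note f = l2_rep_in(2)[OF assms(1)] and g = l2_rep_in(2)[OF assms(2)]
  let ?h = "l2_rep (l2_scale M (-1) G)"
  have sg: "(\<lambda>s. -1 * l2_rep G s) \<in> l2_funs M"
    by (rule l2_funs_scale[OF g])
  have h: "?h \<in> l2_funs M" "AE s in M. ?h s = -1 * l2_rep G s"
    unfolding l2_scale_def using l2_rep_in(2)[OF l2_class_in[OF sg]] l2_rep_class_AE[OF sg] by auto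
  have "l2_norm M (l2_add M F (l2_scale M (-1) G)) = sqrt (\<integral>s. (l2_rep F s + ?h s)\<^sup>2 \<partial>M)"
    unfolding l2_add_def by (rule l2_norm_class[OF l2_funs_add[OF f h(1)]])
  also have "(\<integral>s. (l2_rep F s + ?h s)\<^sup>2 \<partial>M) = (\<integral>s. (l2_rep F s - l2_rep G s)\<^sup>2 \<partial>M)"
  proof (rule integral_cong_AE)
    show "AE s in M. (l2_rep F s + ?h s)\<^sup>2 = (l2_rep F s - l2_rep G s)\<^sup>2"
      using h(2) by eventually_elim simp
  qed (use f g h(1) in \<open>auto simp: l2_funs_def\<close>)
  finally show ?thesis by (simp add: l2_dist_def)
qed

lemma l2_triangle:
  assumes f: "f \<in> l2_funs M" and g: "g \<in> l2_funs M"
  shows "sqrt (\<integral>s. (f s + g s)\<^sup>2 \<partial>M) \<le> sqrt (\<integral>s. (f s)\<^sup>2 \<partial>M) + sqrt (\<integral>s. (g s)\<^sup>2 \<partial>M)"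
proof -
  define A where "A = (\<integral>s. (f s)\<^sup>2 \<partial>M)"
  define B where "B = (\<integral>s. (g s)\<^sup>2 \<partial>M)"
  define I where "I = (\<integral>s. f s * g s \<partial>M)"
  have AB: "A \<ge> 0" "B \<ge> 0" by (auto simp: A_def B_def)
  have ints: "integrable M (\<lambda>s. (f s)\<^sup>2)" "integrable M (\<lambda>s. (g s)\<^sup>2)"
    "integrable M (\<lambda>s. f s * g s)"
    using f g l2_funs_mult_integrable[OF f g] by (auto simp: l2_funs_def)
  have exp: "(\<integral>s. (p * f s + q * g s)\<^sup>2 \<partial>M) = p\<^sup>2 * A + 2 * p * q * I + q\<^sup>2 * B" for p q
  proof -
    have "(\<integral>s. (p * f s + q * g s)\<^sup>2 \<partial>M)
        = (\<integral>s. p\<^sup>2 * (f s)\<^sup>2 + (2 * p * q) * (f s * g s) + q\<^sup>2 * (g s)\<^sup>2 \<partial>M)"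
      by (rule Bochner_Integration.integral_cong) (auto simp: power2_eq_square algebra_simps)
    also have "\<dots> = p\<^sup>2 * A + 2 * p * q * I + q\<^sup>2 * B"
      unfolding A_def B_def I_def using ints by simp
    finally show ?thesis .
  qed
  have nn: "0 \<le> p\<^sup>2 * A + 2 * p * q * I + q\<^sup>2 * B" for p q
    unfolding exp[symmetric] by simp
  have "I\<^sup>2 \<le> A * B"
  proof (cases "B = 0")
    case True
    have "I = 0"
    proof (rule ccontr)
      assume "I \<noteq> 0"
      then show False using nn[of 1 "- (A + 1) / I"] True AB by simp
    qed
    then show ?thesis using True by simp
  next
    case False
    with AB have B: "B > 0" by simp
    have "0 \<le> B * (A * B - I\<^sup>2)"
      using nn[of B "- I"] by (simp add: power2_eq_square algebra_simps)
    then show ?thesis using B by (simp add: zero_le_mult_iff)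
  qed
  then have "I \<le> sqrt (A * B)"
    by (rule real_le_rsqrt)
  then have "A + 2 * I + B \<le> (sqrt A + sqrt B)\<^sup>2"
    using AB by (simp add: power2_sum real_sqrt_mult)
  moreover have "(\<integral>s. (f s + g s)\<^sup>2 \<partial>M) = A + 2 * I + B"
    using exp[of 1 1] by simp
  ultimately have "sqrt (\<integral>s. (f s + g s)\<^sup>2 \<partial>M) \<le> sqrt A + sqrt B"
    using AB by (intro real_le_lsqrt) auto
  then show ?thesis by (simp add: A_def B_def)
qed

lemma Metric_space_l2: "Metric_space (l2_space M) (l2_dist M)"
proof
  show "0 \<le> l2_dist M F G" for F G
    by (simp add: l2_dist_def)
  show "l2_dist M F G = l2_dist M G F" for F G
    by (simp add: l2_dist_def power2_commute)
next
  fix F G assume FG: "F \<in> l2_space M" "G \<in> l2_space M"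
  note f = l2_rep_in(2)[OF FG(1)] and g = l2_rep_in(2)[OF FG(2)]
  have "integrable M (\<lambda>s. (l2_rep F s - l2_rep G s)\<^sup>2)"
    using l2_funs_add[OF f l2_funs_scale[OF g, of "-1"]] by (simp add: l2_funs_def)
  then have "l2_dist M F G = 0 \<longleftrightarrow> (AE s in M. l2_rep F s = l2_rep G s)"
    unfolding l2_dist_def
    using integral_nonneg_eq_0_iff_AE[of M "\<lambda>s. (l2_rep F s - l2_rep G s)\<^sup>2"] by simp
  then show "l2_dist M F G = 0 \<longleftrightarrow> F = G"
    using l2_class_eq_iff[OF f g] by (simp add: l2_rep_in(3) FG)
next
  fix F G H assume FGH: "F \<in> l2_space M" "G \<in> l2_space M" "H \<in> l2_space M"
  note f = l2_rep_in(2)[OF FGH(1)] and g = l2_rep_in(2)[OF FGH(2)] and h = l2_rep_in(2)[OF FGH(3)]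
  show "l2_dist M F H \<le> l2_dist M F G + l2_dist M G H"
    using l2_triangle[OF l2_funs_add[OF f l2_funs_scale[OF g, of "-1"]]
        l2_funs_add[OF g l2_funs_scale[OF h, of "-1"]]]
    by (simp add: l2_dist_def)
qed

end

theory Submission
  imports Defs
begin

text \<open>
  Proof idea. The covariance function satisfies
  $V((r,at),(s,au)) = a^{3/2-d(r)} a^{3/2-d(s)} V((r,t),(s,u))$, so the centred Gaussian processes
  $\mathcal X(s,at)$ and $a^{3/2-d(s)} \mathcal X(s,t)$ have the same covariances. What remains is to
  see that the covariances determine the joint laws in $L_2(\mu)$. Since $L_2(\mu)$ is separable, its
  Borel sets are generated by the functionals $F \mapsto \langle F, f\rangle$, and laws are
  determined by the characteristic functions of finite sums $\sum_j \langle F_j, f_j\rangle$. For the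
  process these sums are integrals $\sum_j \int \mathcal X(s,t_j) f_j(s)\,\mu(ds)$, which lie in the
  $L_2(P)$-closed linear span of the Gaussian variables $\mathcal X(s,t)$; so they are centred Gaussian,
  with variance given by Fubini's theorem in terms of $V$.
\<close>

section \<open>Characteristic functions determine a law\<close>

text \<open>A path integral is not a finite combination of the variables X(s,t), so Gaussianity has
  to pass to a limit. Membership in the closed span is therefore tested by duality against
  norm-bounded sequences; for integrals such a test needs only Fubini and dominated convergence. The
  two integrability hypotheses come from cutting the integral \<open>c_int d s s\<close> at 1, which
  bounds it by 1/(1-d(s)) + 1/(2d(s)-1); the factor sigma^2(s)/(1-d(s)) in the variance of X(s,t)
  turns this into the two given integrands. They place each X(.,t) in L2 of the product of P and mu,
  which yields both the square integrable paths and every exchange of integrals. The range 1/2 < d <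
  1 also keeps 3/2-d between 1/2 and 1, so that a^H is bounded by max(1,a). Being self-adjoint, a^H
  passes to the test functions, where it meets the scaling factors of V.\<close>

text \<open>The case \<open>\<theta> = 0\<close> says that both weights have the same mass
  \<open>c\<close>. For \<open>c > 0\<close>, division by \<open>c\<close> gives probability
  measures whose images under \<open>g1\<close> and \<open>g2\<close> have equal characteristic
  functions, and Levy's uniqueness theorem applies. For \<open>c = 0\<close> both weights vanish
  almost everywhere.\<close>

lemma integral_weighted_indicator_eqI:
  fixes w1 g1 :: "'a \<Rightarrow> real" and w2 g2 :: "'b \<Rightarrow> real"
  assumes w1: "integrable M1 w1" "\<And>x. 0 \<le> w1 x" and w2: "integrable M2 w2" "\<And>x. 0 \<le> w2 x"
    and g1[measurable]: "g1 \<in> borel_measurable M1" and g2[measurable]: "g2 \<in> borel_measurable M2"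
    and chr: "\<And>\<theta>. (CLINT x|M1. w1 x * iexp (\<theta> * g1 x)) = (CLINT x|M2. w2 x * iexp (\<theta> * g2 x))"
    and A[measurable]: "A \<in> sets borel"
  shows "(\<integral>x. w1 x * indicator A (g1 x) \<partial>M1) = (\<integral>x. w2 x * indicator A (g2 x) \<partial>M2)"
proof -
  note [measurable] = borel_measurable_integrable[OF w1(1)] borel_measurable_integrable[OF w2(1)]
  define c where "c = (\<integral>x. w1 x \<partial>M1)"
  have c2: "c = (\<integral>x. w2 x \<partial>M2)"
    using chr[of 0] by (simp add: c_def)
  have c0: "c \<ge> 0" by (simp add: c_def w1)
  show ?thesis
  proof (cases "c = 0")
    case True
    have "AE x in M1. w1 x = 0" "AE x in M2. w2 x = 0"
      using True c2 w1 w2 integral_nonneg_eq_0_iff_AE[of M1 w1] integral_nonneg_eq_0_iff_AE[of M2 w2]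
      by (auto simp: c_def)
    then have "AE x in M1. w1 x * indicator A (g1 x) = 0" "AE x in M2. w2 x * indicator A (g2 x) = 0"
      by auto
    then show ?thesis by (simp add: integral_eq_zero_AE)
  next
    case False
    with c0 have c: "c > 0" by simp
    have main: "real_distribution (distr (density N (\<lambda>x. w x / c)) borel g) \<and>
      (\<forall>\<theta>. char (distr (density N (\<lambda>x. w x / c)) borel g) \<theta> = (CLINT x|N. w x * iexp (\<theta> * g x)) / c) \<and>
      measure (distr (density N (\<lambda>x. w x / c)) borel g) A = (\<integral>x. w x * indicator A (g x) \<partial>N) / c"
      if w: "integrable N w" "\<And>x. 0 \<le> w x" "c = (\<integral>x. w x \<partial>N)" and g[measurable]: "g \<in> borel_measurable N"
      for N :: "'c measure" and w g
    proof -
      note [measurable] = borel_measurable_integrable[OF w(1)]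
      let ?D = "density N (\<lambda>x. w x / c)"
      have "emeasure ?D (space ?D) = (\<integral>\<^sup>+x. ennreal (w x / c) \<partial>N)"
        by (subst emeasure_density) (auto intro!: nn_integral_cong)
      also have "\<dots> = ennreal (\<integral>x. w x / c \<partial>N)"
        using w c by (intro nn_integral_eq_integral) auto
      also have "\<dots> = 1" using w(3) c by simp
      finally interpret D: prob_space ?D by (rule prob_spaceI)
      have 1: "real_distribution (distr ?D borel g)"
        using D.real_distribution_distr[of g] by simp
      have 2: "char (distr ?D borel g) \<theta> = (CLINT x|N. w x * iexp (\<theta> * g x)) / c" for \<theta>
      proof -
        have "char (distr ?D borel g) \<theta> = (CLINT x|?D. iexp (\<theta> * g x))"
          unfolding char_def by (subst integral_distr) auto
        also have "\<dots> = (CLINT x|N. (w x / c) *\<^sub>R iexp (\<theta> * g x))"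
          using w c by (subst integral_density) auto
        also have "\<dots> = (CLINT x|N. (w x * iexp (\<theta> * g x)) / c)"
          by (intro Bochner_Integration.integral_cong) (auto simp: scaleR_conv_of_real)
        also have "\<dots> = (CLINT x|N. w x * iexp (\<theta> * g x)) / c"
          by simp
        finally show ?thesis .
      qed
      interpret R: prob_space "distr ?D borel g" by (rule D.prob_space_distr) simp
      have "measure (distr ?D borel g) A = (\<integral>x. indicator A x \<partial>distr ?D borel g)"
        by simp
      also have "\<dots> = (\<integral>x. indicator A (g x) \<partial>?D)"
        by (subst integral_distr) auto
      also have "\<dots> = (\<integral>x. (w x / c) *\<^sub>R indicator A (g x) \<partial>N)"
        using w c by (subst integral_density) auto
      also have "\<dots> = (\<integral>x. w x * indicator A (g x) \<partial>N) / c"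
        by simp
      finally show ?thesis using 1 2 by blast
    qed
    note m1 = main[OF w1 c_def g1] and m2 = main[OF w2 c2 g2]
    have "distr (density M1 (\<lambda>x. w1 x / c)) borel g1 = distr (density M2 (\<lambda>x. w2 x / c)) borel g2"
      using m1 m2 by (intro Levy_uniqueness) (auto simp: chr[simplified] fun_eq_iff)
    then show ?thesis using m1 m2 c by simp
  qed
qed

text \<open>The sine is a shifted cosine, so the real and the imaginary part of an integral against
  \<open>iexp\<close> both belong to one family of cosines with a phase.\<close>

lemma iexp_eq_cos: "iexp x = complex_of_real (cos x) + \<i> * complex_of_real (cos (x - pi / 2))"
  by (simp add: cis_conv_exp[symmetric] complex_eq_iff cos_diff)

text \<open>Euler's formula with a phase: it turns a cosine weight into exponentials, the form in
  which an induction hypothesis about \<open>iexp\<close> can be used.\<close>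

lemma cos_eq_iexp:
  "complex_of_real (cos (x + c)) = iexp c / 2 * iexp x + iexp (- c) / 2 * iexp (- x)"
proof -
  have "iexp c / 2 * iexp x + iexp (- c) / 2 * iexp (- x) = (iexp (x + c) + iexp (- (x + c))) / 2"
    by (simp add: field_simps exp_add[symmetric])
  also have "\<dots> = complex_of_real (cos (x + c))"
    unfolding cos_of_real[symmetric] cos_exp_eq
    by (simp add: algebra_simps)
  finally show ?thesis by simp
qed

text \<open>Trigonometric weights \<open>1 + cos (h + c)\<close> keep the measures positive, so that the
  one-dimensional uniqueness theorem can be applied to one functional at a time.\<close>

lemma measure_eqI_char_functionals:
  fixes L :: "('a \<Rightarrow> real) set"
  assumes "prob_space M1" "prob_space M2" and sets: "sets M1 = sets M2"
    and meas: "\<And>h. h \<in> L \<Longrightarrow> h \<in> borel_measurable M1"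
    and zero: "(\<lambda>_. 0) \<in> L"
    and lin: "\<And>g h a b. g \<in> L \<Longrightarrow> h \<in> L \<Longrightarrow> \<exists>k\<in>L. \<forall>x\<in>space M1. k x = a * g x + b * h x"
    and chr: "\<And>h. h \<in> L \<Longrightarrow> (CLINT x|M1. iexp (h x)) = (CLINT x|M2. iexp (h x))"
    and gen: "sets M1 \<subseteq> sigma_sets (space M1) {h -` A \<inter> space M1 |h A. h \<in> L \<and> A \<in> sets borel}"
  shows "M1 = M2"
proof -
  interpret M1: prob_space M1 by fact
  interpret M2: prob_space M2 by fact
  have space: "space M2 = space M1" using sets_eq_imp_space_eq[OF sets] by simp
  have meas2: "h \<in> borel_measurable M2" if "h \<in> L" for h
    using meas[OF that] sets by (simp cong: measurable_cong_sets)
  \<comment> \<open>Lists suit the induction below: one condition is added at a time, the empty list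
    gives the whole space, and concatenation gives intersections.\<close>
  define cyl where "cyl gs = {x \<in> space M1. \<forall>p\<in>set gs. fst p x \<in> snd p}"
    for gs :: "(('a \<Rightarrow> real) \<times> real set) list"
  have cyl_Cons: "indicator (cyl (p # gs)) x = indicator (cyl gs) x * (indicator (snd p) (fst p x) :: real)"
    for p gs x by (auto simp: cyl_def indicator_def)
  have cyl_sets[measurable]: "cyl gs \<in> sets M1" if "set gs \<subseteq> L \<times> sets borel" for gs
    using that
  proof (induction gs)
    case Nil
    then show ?case by (simp add: cyl_def)
  next
    case (Cons p gs)
    have [measurable]: "fst p \<in> borel_measurable M1" "snd p \<in> sets borel"
      using Cons.prems meas by auto
    have "cyl (p # gs) = cyl gs \<inter> (fst p -` snd p \<inter> space M1)"
      by (auto simp: cyl_def)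
    then show ?case using Cons by auto
  qed
  \<comment> \<open>The induction moves one functional at a time from the exponent into an
    indicator. \<open>h\<close> stays arbitrary because the step uses the hypothesis at linear
    combinations of \<open>g\<close> and \<open>h\<close>.\<close>
  have key: "(CLINT x|M1. indicator (cyl gs) x *\<^sub>R iexp (h x)) = (CLINT x|M2. indicator (cyl gs) x *\<^sub>R iexp (h x))"
    if "set gs \<subseteq> L \<times> sets borel" "h \<in> L" for gs h
    using that
  proof (induction gs arbitrary: h)
    case Nil
    have "(CLINT x|M1. indicator (cyl []) x *\<^sub>R iexp (h x)) = (CLINT x|M1. iexp (h x))"
      "(CLINT x|M2. indicator (cyl []) x *\<^sub>R iexp (h x)) = (CLINT x|M2. iexp (h x))"
      by (auto intro!: Bochner_Integration.integral_cong simp: cyl_def space)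
    then show ?case using chr[OF Nil(2)] by simp
  next
    case (Cons p gs)
    obtain g A where p: "p = (g, A)" by force
    have g: "g \<in> L" and [measurable]: "A \<in> sets borel" and gs: "set gs \<subseteq> L \<times> sets borel"
      using Cons.prems p by auto
    note h = Cons.prems(2)
    note [measurable] = meas[OF g] meas2[OF g] meas[OF h] meas2[OF h]
    have B1[measurable]: "cyl gs \<in> sets M1" by (rule cyl_sets[OF gs])
    then have B2[measurable]: "cyl gs \<in> sets M2" by (simp add: sets)
    \<comment> \<open>\<open>w\<close> is the nonnegative weight that the uniqueness lemma admits;
      \<open>W\<close> is the signed integrand that is wanted, with the new condition on
      \<open>g\<close> included.\<close>
    define w where "w c x = indicator (cyl gs) x * (1 + cos (h x + c))" for c x
    define W where "W c x = indicator (cyl gs) x * indicator A (g x) * cos (h x + c)" for c x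
    have w0: "0 \<le> w c x" for c x
    proof -
      have "0 \<le> 1 + cos (h x + c)" using cos_ge_minus_one[of "h x + c"] by linarith
      then show ?thesis by (simp add: w_def)
    qed
    have wb: "norm (w c x) \<le> 2" for c x
      using w0[of c x] cos_le_one[of "h x + c"] by (auto simp: w_def indicator_def)
    have wint: "integrable M1 (w c)" "integrable M2 (w c)" for c
    proof -
      have [measurable]: "w c \<in> borel_measurable M1" "w c \<in> borel_measurable M2"
        unfolding w_def by measurable
      show "integrable M1 (w c)" "integrable M2 (w c)"
        using wb by (auto intro!: M1.integrable_const_bound[of _ 2] M2.integrable_const_bound[of _ 2])
    qed
    have Wint: "integrable M1 (W c)" "integrable M2 (W c)" for c
    proof -
      have [measurable]: "W c \<in> borel_measurable M1" "W c \<in> borel_measurable M2"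
        unfolding W_def by measurable
      show "integrable M1 (W c)" "integrable M2 (W c)"
        by (auto intro!: M1.integrable_const_bound[of _ 1] M2.integrable_const_bound[of _ 1]
            simp: W_def indicator_def)
    qed
    have lin_comb: "(CLINT x|M1. indicator (cyl gs) x *\<^sub>R iexp (a * g x + b * h x)) =
        (CLINT x|M2. indicator (cyl gs) x *\<^sub>R iexp (a * g x + b * h x))" for a b
    proof -
      obtain k where k: "k \<in> L" "\<forall>x\<in>space M1. k x = a * g x + b * h x"
        using lin[OF g h] by blast
      have "(CLINT x|M1. indicator (cyl gs) x *\<^sub>R iexp (a * g x + b * h x)) =
        (CLINT x|M1. indicator (cyl gs) x *\<^sub>R iexp (k x))"
        "(CLINT x|M2. indicator (cyl gs) x *\<^sub>R iexp (a * g x + b * h x)) =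
        (CLINT x|M2. indicator (cyl gs) x *\<^sub>R iexp (k x))"
        using k(2) by (auto intro!: Bochner_Integration.integral_cong simp: space)
      then show ?thesis using Cons.IH[OF gs k(1)] by simp
    qed
    \<comment> \<open>The factor \<open>1 + cos (h x + c)\<close> contains \<open>h\<close> with the
      frequencies 0, 1 and -1; each of the three integrals is covered by
      \<open>lin_comb\<close>.\<close>
    have expand: "(CLINT x|N. w c x * iexp (\<theta> * g x)) =
        (CLINT x|N. indicator (cyl gs) x *\<^sub>R iexp (\<theta> * g x + 0 * h x))
        + iexp c / 2 * (CLINT x|N. indicator (cyl gs) x *\<^sub>R iexp (\<theta> * g x + 1 * h x))
        + iexp (- c) / 2 * (CLINT x|N. indicator (cyl gs) x *\<^sub>R iexp (\<theta> * g x + (-1) * h x))"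
      if "prob_space N" and [measurable]: "g \<in> borel_measurable N" "h \<in> borel_measurable N" "cyl gs \<in> sets N"
      for N c \<theta>
    proof -
      interpret N: prob_space N by fact
      define e where "e b x = indicator (cyl gs) x *\<^sub>R iexp (\<theta> * g x + b * h x)" for b x
      have int: "integrable N (e b)" for b
      proof -
        have "(\<lambda>x. indicator (cyl gs) x *\<^sub>R iexp (\<theta> * g x + b * h x)) \<in> borel_measurable N" by measurable
        then show ?thesis
          unfolding e_def by (intro N.integrable_const_bound[of _ 1]) (auto simp: indicator_def)
      qed
      have "w c x * iexp (\<theta> * g x) = e 0 x + iexp c / 2 * e 1 x + iexp (- c) / 2 * e (-1) x" for x
        unfolding w_def e_def of_real_mult of_real_add cos_eq_iexp
        by (simp add: scaleR_conv_of_real algebra_simps exp_add exp_diff exp_minus divide_simps)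
      then have "(CLINT x|N. w c x * iexp (\<theta> * g x)) =
          (CLINT x|N. e 0 x) + iexp c / 2 * (CLINT x|N. e 1 x) + iexp (- c) / 2 * (CLINT x|N. e (-1) x)"
        using int by simp
      then show ?thesis unfolding e_def .
    qed
    have "(CLINT x|M1. w c x * iexp (\<theta> * g x)) = (CLINT x|M2. w c x * iexp (\<theta> * g x))" for c \<theta>
      using meas[OF g] meas2[OF g] meas[OF h] meas2[OF h] B1 B2
      by (simp only: expand[OF \<open>prob_space M1\<close>] expand[OF \<open>prob_space M2\<close>] lin_comb)
    then have ww: "(\<integral>x. w c x * indicator A (g x) \<partial>M1) = (\<integral>x. w c x * indicator A (g x) \<partial>M2)" for c
      by (intro integral_weighted_indicator_eqI wint w0) auto
    have WW: "(\<integral>x. W c x \<partial>M1) = (\<integral>x. W c x \<partial>M2)" for c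
    proof -
      \<comment> \<open>A shift of the phase by \<open>pi\<close> changes the sign of the cosine, so
        the constant 1 cancels in the difference and twice the cosine remains.\<close>
      have W: "W c = (\<lambda>x. (w c x * indicator A (g x) - w (c + pi) x * indicator A (g x)) / 2)"
        by (simp add: W_def w_def cos_add algebra_simps fun_eq_iff)
      have int: "integrable M1 (\<lambda>x. w c x * indicator A (g x))" "integrable M2 (\<lambda>x. w c x * indicator A (g x))" for c
        using wint[of c] by (auto intro: Bochner_Integration.integrable_bound simp: indicator_def)
      show ?thesis
        unfolding W integral_divide_zero Bochner_Integration.integral_diff[OF int(1) int(1)]
          Bochner_Integration.integral_diff[OF int(2) int(2)] ww ..
    qed
    have split: "(CLINT x|N. indicator (cyl (p # gs)) x *\<^sub>R iexp (h x)) =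
        complex_of_real (\<integral>x. W 0 x \<partial>N) + \<i> * complex_of_real (\<integral>x. W (- pi / 2) x \<partial>N)"
      if "integrable N (W 0)" "integrable N (W (- pi / 2))" for N
    proof -
      have "(CLINT x|N. indicator (cyl (p # gs)) x *\<^sub>R iexp (h x)) =
        (CLINT x|N. complex_of_real (W 0 x) + \<i> * complex_of_real (W (- pi / 2) x))"
        unfolding cyl_Cons p iexp_eq_cos W_def
        by (intro Bochner_Integration.integral_cong) (auto simp: scaleR_conv_of_real algebra_simps)
      also have "\<dots> = complex_of_real (\<integral>x. W 0 x \<partial>N) + \<i> * complex_of_real (\<integral>x. W (- pi / 2) x \<partial>N)"
        using that by simp
      finally show ?thesis .
    qed
    show ?case
      by (simp add: split Wint WW del: of_real_eq_iff)
  qed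
  define E where "E = cyl ` {gs. set gs \<subseteq> L \<times> sets borel}"
  have E_sets: "E \<subseteq> sets M1" by (auto simp: E_def)
  have gen_E: "sets M1 = sigma_sets (space M1) E"
  proof
    show "sigma_sets (space M1) E \<subseteq> sets M1"
      using E_sets by (rule sets.sigma_sets_subset)
    have "{h -` A \<inter> space M1 |h A. h \<in> L \<and> A \<in> sets borel} \<subseteq> E"
    proof safe
      fix h and A :: "real set" assume "h \<in> L" "A \<in> sets borel"
      moreover have "h -` A \<inter> space M1 = cyl [(h, A)]" by (auto simp: cyl_def)
      ultimately show "h -` A \<inter> space M1 \<in> E" by (auto simp: E_def)
    qed
    then have "{h -` A \<inter> space M1 |h A. h \<in> L \<and> A \<in> sets borel} \<subseteq> sigma_sets (space M1) E"
      by (auto intro: sigma_sets.Basic)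
    from sigma_sets_mono[OF this] gen
    show "sets M1 \<subseteq> sigma_sets (space M1) E" by blast
  qed
  show ?thesis
  proof (rule measure_eqI_generator_eq[where A = "\<lambda>_. space M1" and \<Omega> = "space M1" and E = E])
    show "Int_stable E"
    proof (rule Int_stableI)
      fix a b assume "a \<in> E" "b \<in> E"
      then obtain gs hs where "a = cyl gs" "b = cyl hs" "set gs \<subseteq> L \<times> sets borel" "set hs \<subseteq> L \<times> sets borel"
        by (auto simp: E_def)
      moreover from this have "a \<inter> b = cyl (gs @ hs)" by (auto simp: cyl_def)
      ultimately show "a \<inter> b \<in> E" by (auto simp: E_def intro!: image_eqI[of _ _ "gs @ hs"])
    qed
    show "E \<subseteq> Pow (space M1)" using E_sets sets.sets_into_space by auto
    show "sets M1 = sigma_sets (space M1) E" by (rule gen_E)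
    show "sets M2 = sigma_sets (space M1) E" using gen_E sets by simp
    show "range (\<lambda>_. space M1) \<subseteq> E"
      by (auto simp: E_def cyl_def intro!: image_eqI[of _ _ "[]"])
    fix C assume "C \<in> E"
    then obtain gs where C: "C = cyl gs" "set gs \<subseteq> L \<times> sets borel" by (auto simp: E_def)
    have C1: "C \<in> sets M1" "C \<in> sets M2" using C cyl_sets sets by auto
    \<comment> \<open>At the zero functional the exponential is 1, and \<open>key\<close> compares
      the measures of the cylinder.\<close>
    have "complex_of_real (measure M1 C) = complex_of_real (measure M2 C)"
      using key[OF C(2) zero] C1 C(1)
      by (simp add: scaleR_conv_of_real)
    then show "emeasure M1 C = emeasure M2 C"
      by (simp add: M1.emeasure_eq_measure M2.emeasure_eq_measure)
  qed auto
qed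

section \<open>Borel sets and inner products of $L_2(\mu)$\<close>

text \<open>The second argument is a function rather than a class, so products such as
  \<open>h s * f s\<close> can serve as test functions without a choice of representative.\<close>

definition l2_inner :: "'s measure \<Rightarrow> ('s \<Rightarrow> real) set \<Rightarrow> ('s \<Rightarrow> real) \<Rightarrow> real" where
  "l2_inner M F f = (\<integral>s. l2_rep F s * f s \<partial>M)"

lemma l2_funs_zero: "(\<lambda>_. 0) \<in> l2_funs M"
  by (simp add: l2_funs_def)

lemma l2_funs_mult_bounded:
  assumes h[measurable]: "h \<in> borel_measurable M" and K: "\<forall>s\<in>space M. \<bar>h s\<bar> \<le> K" and f: "f \<in> l2_funs M"
  shows "(\<lambda>s. h s * f s) \<in> l2_funs M"
proof -
  have [measurable]: "f \<in> borel_measurable M" using f by (simp add: l2_funs_def)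
  have "integrable M (\<lambda>s. (h s * f s)\<^sup>2)"
  proof (rule Bochner_Integration.integrable_bound)
    show "integrable M (\<lambda>s. K\<^sup>2 * (f s)\<^sup>2)" using f by (simp add: l2_funs_def)
    show "AE s in M. norm ((h s * f s)\<^sup>2) \<le> norm (K\<^sup>2 * (f s)\<^sup>2)"
    proof (rule AE_I2)
      fix s assume "s \<in> space M"
      then have "(h s)\<^sup>2 \<le> K\<^sup>2" using power_mono[of "\<bar>h s\<bar>" K 2] K by simp
      then show "norm ((h s * f s)\<^sup>2) \<le> norm (K\<^sup>2 * (f s)\<^sup>2)"
        by (simp add: power_mult_distrib mult_right_mono)
    qed
  qed measurable
  then show ?thesis by (simp add: l2_funs_def)
qed

lemma l2_inner_class:
  assumes f: "f \<in> l2_funs M" and [measurable]: "g \<in> borel_measurable M"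
  shows "l2_inner M (l2_class M f) g = (\<integral>s. f s * g s \<partial>M)"
proof -
  have [measurable]: "f \<in> borel_measurable M" "l2_rep (l2_class M f) \<in> borel_measurable M"
    using f l2_rep_in(2)[OF l2_class_in[OF f]] by (auto simp: l2_funs_def)
  show ?thesis
    unfolding l2_inner_def using l2_rep_class_AE[OF f] by (intro integral_cong_AE) auto
qed

lemma l2_inner_zero: "l2_inner M F (\<lambda>_. 0) = 0"
  by (simp add: l2_inner_def)

lemma l2_inner_lincomb:
  assumes "F \<in> l2_space M" "f \<in> l2_funs M" "g \<in> l2_funs M"
  shows "l2_inner M F (\<lambda>s. a * f s + b * g s) = a * l2_inner M F f + b * l2_inner M F g"
proof -
  note F = l2_rep_in(2)[OF assms(1)]
  have "l2_inner M F (\<lambda>s. a * f s + b * g s) = (\<integral>s. a * (l2_rep F s * f s) + b * (l2_rep F s * g s) \<partial>M)"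
    unfolding l2_inner_def by (intro Bochner_Integration.integral_cong) (auto simp: algebra_simps)
  also have "\<dots> = a * l2_inner M F f + b * l2_inner M F g"
    unfolding l2_inner_def
    using l2_funs_mult_integrable[OF F assms(2)] l2_funs_mult_integrable[OF F assms(3)] by simp
  finally show ?thesis .
qed

text \<open>This identity is used in both directions: to obtain inner products from distances, whose
  measurability comes from open balls, and to recover distances from norms and inner
  products.\<close>

lemma l2_dist_power2:
  assumes "F \<in> l2_space M" "G \<in> l2_space M"
  shows "(l2_dist M F G)\<^sup>2 = (l2_norm M F)\<^sup>2 - 2 * l2_inner M F (l2_rep G) + (l2_norm M G)\<^sup>2"
proof -
  note F = l2_rep_in(2)[OF assms(1)] and G = l2_rep_in(2)[OF assms(2)]
  have "(l2_dist M F G)\<^sup>2 = (\<integral>s. (l2_rep F s - l2_rep G s)\<^sup>2 \<partial>M)"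
    by (simp add: l2_dist_def)
  also have "\<dots> = (\<integral>s. (l2_rep F s)\<^sup>2 - 2 * (l2_rep F s * l2_rep G s) + (l2_rep G s)\<^sup>2 \<partial>M)"
    by (auto intro!: Bochner_Integration.integral_cong simp: power2_eq_square algebra_simps)
  also have "\<dots> = (\<integral>s. (l2_rep F s)\<^sup>2 \<partial>M) - 2 * l2_inner M F (l2_rep G) + (\<integral>s. (l2_rep G s)\<^sup>2 \<partial>M)"
    unfolding l2_inner_def
    using F G l2_funs_mult_integrable[OF F G] by (simp add: l2_funs_def)
  finally show ?thesis by (simp add: l2_norm_def)
qed

lemma space_l2_borel: "space (l2_borel M) = l2_space M"
  by (simp add: l2_borel_def space_measure_of_conv)

lemma openin_l2_subset: "{U. openin (l2_topology M) U} \<subseteq> Pow (l2_space M)"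
  unfolding l2_topology_def using Metric_space.openin_mtopology[OF Metric_space_l2] by blast

lemma sets_l2_borel_open: "openin (l2_topology M) U \<Longrightarrow> U \<in> sets (l2_borel M)"
  unfolding l2_borel_def using openin_l2_subset by (subst sets_measure_of) auto

lemma borel_measurable_l2_dist: "(\<lambda>F. l2_dist M G F) \<in> borel_measurable (l2_borel M)" if "G \<in> l2_space M"
proof (rule borel_measurableI_less)
  interpret Metric_space "l2_space M" "l2_dist M" by (rule Metric_space_l2)
  fix r
  have "{F \<in> space (l2_borel M). l2_dist M G F < r} = mball G r"
    using that by (auto simp: space_l2_borel)
  then show "{F \<in> space (l2_borel M). l2_dist M G F < r} \<in> sets (l2_borel M)"
    using openin_mball by (auto intro!: sets_l2_borel_open simp: l2_topology_def)
qed

text \<open>Polarisation writes the inner product through the distances of \<open>F\<close> to the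
  class of \<open>f\<close> and to zero, and these are measurable because balls are open.\<close>

lemma borel_measurable_l2_inner:
  assumes f: "f \<in> l2_funs M"
  shows "(\<lambda>F. l2_inner M F f) \<in> borel_measurable (l2_borel M)"
proof -
  interpret Metric_space "l2_space M" "l2_dist M" by (rule Metric_space_l2)
  let ?Z = "l2_class M (\<lambda>_. 0)" and ?G = "l2_class M f"
  have Z: "?Z \<in> l2_space M" and G: "?G \<in> l2_space M"
    using l2_class_in f l2_funs_zero by auto
  have [measurable]: "f \<in> borel_measurable M" using f by (simp add: l2_funs_def)
  have eq: "l2_inner M F f = ((l2_dist M ?Z F)\<^sup>2 + (l2_norm M ?G)\<^sup>2 - (l2_dist M ?G F)\<^sup>2) / 2"
    if F: "F \<in> l2_space M" for F
  proof -
    have [measurable]: "l2_rep F \<in> borel_measurable M" "l2_rep ?G \<in> borel_measurable M" "l2_rep ?Z \<in> borel_measurable M"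
      using l2_rep_in(2)[OF F] l2_rep_in(2)[OF G] l2_rep_in(2)[OF Z] by (auto simp: l2_funs_def)
    have "l2_inner M F (l2_rep ?G) = l2_inner M F f"
      unfolding l2_inner_def using l2_rep_class_AE[OF f] by (intro integral_cong_AE) auto
    moreover have "l2_inner M F (l2_rep ?Z) = l2_inner M F (\<lambda>_. 0)"
      unfolding l2_inner_def using l2_rep_class_AE[OF l2_funs_zero[of M]] by (intro integral_cong_AE) auto
    moreover have "l2_norm M ?Z = 0"
      by (simp add: l2_norm_class[OF l2_funs_zero])
    ultimately show ?thesis
      using l2_dist_power2[OF F G] l2_dist_power2[OF F Z] by (simp add: commute l2_inner_zero)
  qed
  note [measurable] = borel_measurable_l2_dist[OF Z] borel_measurable_l2_dist[OF G]
  have "(\<lambda>F. ((l2_dist M ?Z F)\<^sup>2 + (l2_norm M ?G)\<^sup>2 - (l2_dist M ?G F)\<^sup>2) / 2) \<in> borel_measurable (l2_borel M)"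
    by measurable
  then show ?thesis
    by (rule measurable_cong[THEN iffD2, rotated]) (simp add: space_l2_borel eq)
qed

text \<open>Pettis' theorem for $L_2(\mu)$: with \<open>G\<close> ranging over a countable dense set,
  $\|F\|^2 = \sup_G (2 \langle F, G \rangle - \|G\|^2)$, because the difference is $\|F - G\|^2$.\<close>

lemma measurable_l2_borelI:
  assumes sep: "separable_space (l2_topology M)"
    and space: "\<And>\<omega>. \<omega> \<in> space N \<Longrightarrow> \<xi> \<omega> \<in> l2_space M"
    and weak: "\<And>f. f \<in> l2_funs M \<Longrightarrow> (\<lambda>\<omega>. l2_inner M (\<xi> \<omega>) f) \<in> borel_measurable N"
  shows "\<xi> \<in> measurable N (l2_borel M)"
proof -
  interpret Metric_space "l2_space M" "l2_dist M" by (rule Metric_space_l2)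
  obtain D where D: "countable D" "D \<subseteq> l2_space M" "mtopology closure_of D = l2_space M"
    using sep by (auto simp: separable_space_def l2_topology_def)
  have dense: "\<exists>G\<in>D. l2_dist M F G < r" if "F \<in> l2_space M" "r > 0" for F r
  proof -
    have "F \<in> mtopology closure_of D" using that D by simp
    then show ?thesis using that by (force simp: metric_closure_of)
  qed
  have norm_gt: "c < (l2_norm M F)\<^sup>2 \<longleftrightarrow> (\<exists>G\<in>D. c < 2 * l2_inner M F (l2_rep G) - (l2_norm M G)\<^sup>2)"
    if F: "F \<in> l2_space M" for F c
  proof
    assume c: "c < (l2_norm M F)\<^sup>2"
    \<comment> \<open>The radius is chosen so that
      \<open>(l2_dist M F G)\<^sup>2 < (l2_norm M F)\<^sup>2 - c\<close>, which after expanding the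
      square is the required inequality.\<close>
    then obtain G where G: "G \<in> D" "l2_dist M F G < sqrt ((l2_norm M F)\<^sup>2 - c)"
      using dense[OF F, of "sqrt ((l2_norm M F)\<^sup>2 - c)"] by auto
    have "(l2_dist M F G)\<^sup>2 < (sqrt ((l2_norm M F)\<^sup>2 - c))\<^sup>2"
      using G by (intro power_strict_mono) auto
    then have "(l2_dist M F G)\<^sup>2 < (l2_norm M F)\<^sup>2 - c" using c by simp
    then have "c < 2 * l2_inner M F (l2_rep G) - (l2_norm M G)\<^sup>2"
      using l2_dist_power2[OF F, of G] G(1) D(2) by auto
    then show "\<exists>G\<in>D. c < 2 * l2_inner M F (l2_rep G) - (l2_norm M G)\<^sup>2" using G(1) by blast
  next
    assume "\<exists>G\<in>D. c < 2 * l2_inner M F (l2_rep G) - (l2_norm M G)\<^sup>2"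
    then obtain G where G: "G \<in> D" "c < 2 * l2_inner M F (l2_rep G) - (l2_norm M G)\<^sup>2" by blast
    moreover have "(l2_dist M F G)\<^sup>2 = (l2_norm M F)\<^sup>2 - 2 * l2_inner M F (l2_rep G) + (l2_norm M G)\<^sup>2"
      using l2_dist_power2[OF F] G D by auto
    ultimately show "c < (l2_norm M F)\<^sup>2" using zero_le_power2[of "l2_dist M F G"] by linarith
  qed
  have inner[measurable]: "(\<lambda>\<omega>. l2_inner M (\<xi> \<omega>) (l2_rep G)) \<in> borel_measurable N" if "G \<in> l2_space M" for G
    using l2_rep_in(2)[OF that] by (rule weak)
  have norm[measurable]: "(\<lambda>\<omega>. (l2_norm M (\<xi> \<omega>))\<^sup>2) \<in> borel_measurable N"
  proof (rule borel_measurableI_greater)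
    fix c
    have "{\<omega> \<in> space N. c < (l2_norm M (\<xi> \<omega>))\<^sup>2} =
        (\<Union>G\<in>D. {\<omega> \<in> space N. c < 2 * l2_inner M (\<xi> \<omega>) (l2_rep G) - (l2_norm M G)\<^sup>2})"
      using norm_gt[OF space] by auto
    also have "\<dots> \<in> sets N"
    proof (rule sets.countable_UN''[OF D(1)])
      fix G assume "G \<in> D"
      then have "G \<in> l2_space M" using D(2) by auto
      note [measurable] = inner[OF this]
      show "{\<omega> \<in> space N. c < 2 * l2_inner M (\<xi> \<omega>) (l2_rep G) - (l2_norm M G)\<^sup>2} \<in> sets N"
        by measurable
    qed
    finally show "{\<omega> \<in> space N. c < (l2_norm M (\<xi> \<omega>))\<^sup>2} \<in> sets N" .
  qed
  have ball: "{\<omega> \<in> space N. l2_dist M G (\<xi> \<omega>) < r} \<in> sets N" if G: "G \<in> l2_space M" for G r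
  proof -
    note [measurable] = inner[OF G]
    have "l2_dist M G (\<xi> \<omega>) = sqrt ((l2_norm M (\<xi> \<omega>))\<^sup>2 - 2 * l2_inner M (\<xi> \<omega>) (l2_rep G) + (l2_norm M G)\<^sup>2)"
      if "\<omega> \<in> space N" for \<omega>
      using l2_dist_power2[OF space[OF that] G, symmetric] commute[of G "\<xi> \<omega>"] by simp
    then have "{\<omega> \<in> space N. l2_dist M G (\<xi> \<omega>) < r} =
      {\<omega> \<in> space N. sqrt ((l2_norm M (\<xi> \<omega>))\<^sup>2 - 2 * l2_inner M (\<xi> \<omega>) (l2_rep G) + (l2_norm M G)\<^sup>2) < r}"
      by auto
    also have "\<dots> \<in> sets N" by measurable
    finally show ?thesis .
  qed
  show ?thesis
    unfolding l2_borel_def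
  proof (rule measurable_measure_of[OF openin_l2_subset])
    show "\<xi> \<in> space N \<rightarrow> l2_space M" using space by auto
    fix U assume "U \<in> {U. openin (l2_topology M) U}"
    then have U: "U \<subseteq> l2_space M" "\<And>F. F \<in> U \<Longrightarrow> \<exists>r>0. mball F r \<subseteq> U"
      by (auto simp: l2_topology_def openin_mtopology)
    \<comment> \<open>Balls with centre in \<open>D\<close> and rational radius form a countable
      base, so \<open>U\<close> is a countable union of balls. Below, \<open>q < r / 2\<close> makes
      a ball of radius \<open>q\<close> whose centre is within \<open>q\<close> of the given point
      stay inside the ball of radius \<open>r\<close>.\<close>
    define I where "I = {(G, q). G \<in> D \<and> q \<in> \<rat> \<and> mball G q \<subseteq> U}"
    have "I \<subseteq> D \<times> \<rat>" by (auto simp: I_def)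
    then have I: "countable I"
      by (rule countable_subset) (intro countable_SIGMA D countable_rat)
    have "\<xi> -` U \<inter> space N = (\<Union>p\<in>I. {\<omega> \<in> space N. l2_dist M (fst p) (\<xi> \<omega>) < snd p})"
    proof (rule set_eqI, rule iffI)
      fix \<omega> assume "\<omega> \<in> \<xi> -` U \<inter> space N"
      then have \<omega>: "\<omega> \<in> space N" "\<xi> \<omega> \<in> U" by auto
      note F = space[OF \<omega>(1)]
      obtain r where r: "r > 0" "mball (\<xi> \<omega>) r \<subseteq> U" using U(2)[OF \<omega>(2)] by blast
      obtain q where q: "q \<in> \<rat>" "0 < q" "q < r / 2" using Rats_dense_in_real[of 0 "r / 2"] r by auto
      obtain G where G: "G \<in> D" "l2_dist M (\<xi> \<omega>) G < q" using dense[OF F q(2)] by blast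
      have Gs: "G \<in> l2_space M" using G D by auto
      have "mball G q \<subseteq> mball (\<xi> \<omega>) r"
      proof
        fix H assume "H \<in> mball G q"
        then have "H \<in> l2_space M" "l2_dist M G H < q" by auto
        then show "H \<in> mball (\<xi> \<omega>) r"
          using triangle[OF F Gs, of H] G(2) q(3) F by auto
      qed
      then have "(G, q) \<in> I" using G q r by (auto simp: I_def)
      moreover have "l2_dist M G (\<xi> \<omega>) < q" using G by (simp add: commute)
      ultimately show "\<omega> \<in> (\<Union>p\<in>I. {\<omega> \<in> space N. l2_dist M (fst p) (\<xi> \<omega>) < snd p})"
        using \<omega> by (intro UN_I[of "(G, q)"]) auto
    next
      fix \<omega> assume "\<omega> \<in> (\<Union>p\<in>I. {\<omega> \<in> space N. l2_dist M (fst p) (\<xi> \<omega>) < snd p})"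
      then obtain G q where *: "(G, q) \<in> I" "\<omega> \<in> space N" "l2_dist M G (\<xi> \<omega>) < q" by auto
      then have "\<xi> \<omega> \<in> mball G q" using space D(2) by (auto simp: I_def)
      then show "\<omega> \<in> \<xi> -` U \<inter> space N" using * by (auto simp: I_def)
    qed
    also have "\<dots> \<in> sets N"
      using I by (rule sets.countable_UN'') (use ball D(2) in \<open>auto simp: I_def\<close>)
    finally show "\<xi> -` U \<inter> space N \<in> sets N" .
  qed
qed

text \<open>Let \<open>N\<close> carry the sigma-algebra generated by the functionals. Each
  coordinate is weakly measurable on \<open>N\<close>, hence measurable by separability, so the
  identity from \<open>N\<close> to the product space is measurable.\<close>

lemma sets_PiM_l2_borel_subset:
  assumes sep: "separable_space (l2_topology M)" and J: "finite J"
  defines "S \<equiv> \<Pi>\<^sub>M j\<in>J. l2_borel M"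
  shows "sets S \<subseteq> sigma_sets (space S)
    {h -` A \<inter> space S |h A. h \<in> {\<lambda>x. \<Sum>j\<in>J. l2_inner M (x j) (f j) |f. \<forall>j\<in>J. f j \<in> l2_funs M} \<and> A \<in> sets borel}"
    (is "_ \<subseteq> sigma_sets _ ?E")
proof -
  define N where "N = sigma (space S) ?E"
  have E: "?E \<subseteq> Pow (space S)" by auto
  have space_N: "space N = space S" unfolding N_def using E by (rule space_measure_of)
  have sets_N: "sets N = sigma_sets (space S) ?E" unfolding N_def using E by (rule sets_measure_of)
  have space_S: "space S = J \<rightarrow>\<^sub>E l2_space M" by (simp add: S_def space_PiM space_l2_borel)
  have "(\<lambda>x. x j) \<in> measurable N (l2_borel M)" if j: "j \<in> J" for j
  proof (rule measurable_l2_borelI[OF sep])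
    show "x j \<in> l2_space M" if "x \<in> space N" for x
      using that j by (auto simp: space_N space_S)
    fix f assume f: "f \<in> l2_funs M"
    \<comment> \<open>Zero test functions away from \<open>j\<close> collapse the sum to the single
      coordinate \<open>j\<close>.\<close>
    define f' where "f' i = (if i = j then f else (\<lambda>_. 0))" for i
    have "(\<Sum>i\<in>J. l2_inner M (x i) (f' i)) = (\<Sum>i\<in>J. if i = j then l2_inner M (x j) f else 0)" for x
      by (intro sum.cong) (auto simp: f'_def l2_inner_zero)
    then have h: "(\<Sum>i\<in>J. l2_inner M (x i) (f' i)) = l2_inner M (x j) f" for x
      using J j by simp
    have f': "\<forall>i\<in>J. f' i \<in> l2_funs M" using f l2_funs_zero by (auto simp: f'_def)
    show "(\<lambda>x. l2_inner M (x j) f) \<in> borel_measurable N"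
    proof (rule measurableI)
      fix A :: "real set" assume A: "A \<in> sets borel"
      have "(\<lambda>x. l2_inner M (x j) f) -` A \<inter> space N \<in> ?E"
        unfolding space_N using f' A h[symmetric] by blast
      then show "(\<lambda>x. l2_inner M (x j) f) -` A \<inter> space N \<in> sets N"
        unfolding sets_N by (rule sigma_sets.Basic)
    qed auto
  qed
  then have id: "(\<lambda>x j. x j) \<in> measurable N S"
    unfolding S_def by (rule measurable_PiM_single') (auto simp: space_N space_S space_l2_borel)
  show ?thesis
  proof
    fix A assume A: "A \<in> sets S"
    then have "A \<inter> space N \<in> sets N" using measurable_sets[OF id A] by simp
    moreover have "A \<inter> space N = A" using sets.sets_into_space[OF A] by (auto simp: space_N)
    ultimately show "A \<in> sigma_sets (space S) ?E" by (simp add: sets_N)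
  qed
qed

text \<open>The Cramer-Wold device: the sums of inner products form a linear class that generates
  the product sigma-algebra. Scalar multiples are absorbed into the test functions, so no frequency
  parameter appears in \<open>chr\<close>.\<close>

lemma distr_l2_eqI:
  assumes P: "prob_space P" and sep: "separable_space (l2_topology M)" and J: "finite J"
    and \<xi>: "\<And>j. j \<in> J \<Longrightarrow> \<xi> j \<in> measurable P (l2_borel M)"
    and \<eta>: "\<And>j. j \<in> J \<Longrightarrow> \<eta> j \<in> measurable P (l2_borel M)"
    and chr: "\<And>f. \<forall>j\<in>J. f j \<in> l2_funs M \<Longrightarrow>
      (CLINT \<omega>|P. iexp (\<Sum>j\<in>J. l2_inner M (\<xi> j \<omega>) (f j))) = (CLINT \<omega>|P. iexp (\<Sum>j\<in>J. l2_inner M (\<eta> j \<omega>) (f j)))"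
  shows "distr P (\<Pi>\<^sub>M j\<in>J. l2_borel M) (\<lambda>\<omega>. \<lambda>j\<in>J. \<xi> j \<omega>) = distr P (\<Pi>\<^sub>M j\<in>J. l2_borel M) (\<lambda>\<omega>. \<lambda>j\<in>J. \<eta> j \<omega>)"
proof -
  interpret prob_space P by fact
  define S where "S = (\<Pi>\<^sub>M j\<in>J. l2_borel M)"
  define L where "L = {\<lambda>x. \<Sum>j\<in>J. l2_inner M (x j) (f j) |f. \<forall>j\<in>J. f j \<in> l2_funs M}"
  have \<xi>': "(\<lambda>\<omega>. \<lambda>j\<in>J. \<xi> j \<omega>) \<in> measurable P S" and \<eta>': "(\<lambda>\<omega>. \<lambda>j\<in>J. \<eta> j \<omega>) \<in> measurable P S"
    unfolding S_def using \<xi> \<eta> by (auto intro!: measurable_restrict)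
  have space_S: "space S = J \<rightarrow>\<^sub>E l2_space M" by (simp add: S_def space_PiM space_l2_borel)
  have L: "h \<in> borel_measurable S" if hL: "h \<in> L" for h
  proof -
    obtain f where h: "h = (\<lambda>x. \<Sum>j\<in>J. l2_inner M (x j) (f j))" and f: "\<forall>j\<in>J. f j \<in> l2_funs M"
      using hL by (auto simp: L_def)
    show ?thesis
      unfolding h
    proof (rule borel_measurable_sum)
      fix j assume j: "j \<in> J"
      have "(\<lambda>x. x j) \<in> measurable S (l2_borel M)"
        unfolding S_def by (rule measurable_component_singleton[OF j])
      then show "(\<lambda>x. l2_inner M (x j) (f j)) \<in> borel_measurable S"
        by (rule measurable_compose[OF _ borel_measurable_l2_inner]) (use f j in auto)
    qed
  qed
  have "distr P S (\<lambda>\<omega>. \<lambda>j\<in>J. \<xi> j \<omega>) = distr P S (\<lambda>\<omega>. \<lambda>j\<in>J. \<eta> j \<omega>)"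
  proof (rule measure_eqI_char_functionals)
    show "prob_space (distr P S (\<lambda>\<omega>. \<lambda>j\<in>J. \<xi> j \<omega>))" "prob_space (distr P S (\<lambda>\<omega>. \<lambda>j\<in>J. \<eta> j \<omega>))"
      using \<xi>' \<eta>' by (auto intro: prob_space_distr)
    show "h \<in> borel_measurable (distr P S (\<lambda>\<omega>. \<lambda>j\<in>J. \<xi> j \<omega>))" if "h \<in> L" for h
      using L[OF that] by simp
    show "(\<lambda>_. 0) \<in> L"
      unfolding L_def by (auto intro!: exI[of _ "\<lambda>_ _. 0"] simp: l2_inner_zero l2_funs_zero)
    show "\<exists>k\<in>L. \<forall>x\<in>space (distr P S (\<lambda>\<omega>. \<lambda>j\<in>J. \<xi> j \<omega>)). k x = a * g x + b * h x" if gh: "g \<in> L" "h \<in> L" for g h a b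
    proof -
      obtain u where u: "g = (\<lambda>x. \<Sum>j\<in>J. l2_inner M (x j) (u j))" "\<forall>j\<in>J. u j \<in> l2_funs M"
        using gh by (auto simp: L_def)
      obtain v where v: "h = (\<lambda>x. \<Sum>j\<in>J. l2_inner M (x j) (v j))" "\<forall>j\<in>J. v j \<in> l2_funs M"
        using gh by (auto simp: L_def)
      define k where "k x = (\<Sum>j\<in>J. l2_inner M (x j) (\<lambda>s. a * u j s + b * v j s))" for x
      have "\<forall>j\<in>J. (\<lambda>s. a * u j s + b * v j s) \<in> l2_funs M"
        using u v by (auto intro!: l2_funs_add l2_funs_scale)
      then have "k \<in> L" unfolding L_def k_def[abs_def] by auto
      \<comment> \<open>Linearity is claimed on the space only, since it rests on square integrable
        representatives of the components of \<open>x\<close>.\<close>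
      moreover have "k x = a * g x + b * h x" if "x \<in> space S" for x
        unfolding k_def u v sum_distrib_left sum.distrib[symmetric]
        using that u(2) v(2) by (intro sum.cong l2_inner_lincomb) (auto simp: space_S)
      ultimately show ?thesis by auto
    qed
    show "(CLINT x|distr P S (\<lambda>\<omega>. \<lambda>j\<in>J. \<xi> j \<omega>). iexp (h x)) = (CLINT x|distr P S (\<lambda>\<omega>. \<lambda>j\<in>J. \<eta> j \<omega>). iexp (h x))"
      if h: "h \<in> L" for h
    proof -
      obtain f where hf: "h = (\<lambda>x. \<Sum>j\<in>J. l2_inner M (x j) (f j))" and f: "\<forall>j\<in>J. f j \<in> l2_funs M"
        using h by (auto simp: L_def)
      note [measurable] = L[OF h] \<xi>' \<eta>'
      have hr: "h (\<lambda>j\<in>J. \<zeta> j \<omega>) = (\<Sum>j\<in>J. l2_inner M (\<zeta> j \<omega>) (f j))" for \<zeta> :: "'c \<Rightarrow> 'a \<Rightarrow> ('b \<Rightarrow> real) set" and \<omega>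
        unfolding hf by (intro sum.cong) auto
      show ?thesis
        using chr[OF f] by (simp add: integral_distr hr)
    qed
    show "sets (distr P S (\<lambda>\<omega>. \<lambda>j\<in>J. \<xi> j \<omega>)) \<subseteq> sigma_sets (space (distr P S (\<lambda>\<omega>. \<lambda>j\<in>J. \<xi> j \<omega>)))
      {h -` A \<inter> space (distr P S (\<lambda>\<omega>. \<lambda>j\<in>J. \<xi> j \<omega>)) |h A. h \<in> L \<and> A \<in> sets borel}"
      using sets_PiM_l2_borel_subset[OF sep J] by (simp add: S_def L_def)
  qed simp
  then show ?thesis by (simp add: S_def)
qed

section \<open>Multiplication operators and induced random elements\<close>

lemma l2_mult_op_class:
  assumes h: "h \<in> borel_measurable M" "\<forall>s\<in>space M. \<bar>h s\<bar> \<le> K" and f: "f \<in> l2_funs M"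
  shows "l2_mult_op M h (l2_class M f) = l2_class M (\<lambda>s. h s * f s)"
  unfolding l2_mult_op_def
  using l2_rep_class_AE[OF f]
  by (subst l2_class_eq_iff) (auto intro!: l2_funs_mult_bounded[OF h] f l2_rep_in(2) l2_class_in)

lemma l2_mult_op_in:
  assumes h: "h \<in> borel_measurable M" "\<forall>s\<in>space M. \<bar>h s\<bar> \<le> K" and F: "F \<in> l2_space M"
  shows "l2_mult_op M h F \<in> l2_space M"
  unfolding l2_mult_op_def by (intro l2_class_in l2_funs_mult_bounded[OF h] l2_rep_in(2) F)

text \<open>Multiplication by a real function is self-adjoint; this is how the operator is moved
  from the random element to the test function.\<close>

lemma l2_inner_mult_op:
  assumes h: "h \<in> borel_measurable M" "\<forall>s\<in>space M. \<bar>h s\<bar> \<le> K" and F: "F \<in> l2_space M"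
    and f: "f \<in> borel_measurable M"
  shows "l2_inner M (l2_mult_op M h F) f = l2_inner M F (\<lambda>s. h s * f s)"
  unfolding l2_mult_op_def
  by (subst l2_inner_class[OF l2_funs_mult_bounded[OF h l2_rep_in(2)[OF F]] f]) (auto simp: l2_inner_def ac_simps)

lemma l2_bounded_linear_mult_op:
  assumes h: "h \<in> borel_measurable M" "\<forall>s\<in>space M. \<bar>h s\<bar> \<le> K" and K: "0 \<le> K"
  shows "l2_bounded_linear M (l2_mult_op M h)"
proof -
  note mult = l2_funs_mult_bounded[OF h]
  have add: "l2_mult_op M h (l2_add M F G) = l2_add M (l2_mult_op M h F) (l2_mult_op M h G)"
    if F: "F \<in> l2_space M" and G: "G \<in> l2_space M" for F G
  proof -
    note f = l2_rep_in(2)[OF F] and g = l2_rep_in(2)[OF G]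
    have "l2_add M (l2_mult_op M h F) (l2_mult_op M h G) = l2_class M (\<lambda>s. h s * (l2_rep F s + l2_rep G s))"
      unfolding l2_add_def l2_mult_op_def
      using l2_rep_class_AE[OF mult[OF f]] l2_rep_class_AE[OF mult[OF g]]
      by (subst l2_class_eq_iff)
        (auto intro!: mult l2_funs_add f g l2_rep_in(2) l2_class_in simp: ring_distribs)
    then show ?thesis
      unfolding l2_add_def using l2_mult_op_class[OF h l2_funs_add[OF f g]] by simp
  qed
  have scale: "l2_mult_op M h (l2_scale M k F) = l2_scale M k (l2_mult_op M h F)"
    if F: "F \<in> l2_space M" for F k
  proof -
    note f = l2_rep_in(2)[OF F]
    have "l2_scale M k (l2_mult_op M h F) = l2_class M (\<lambda>s. h s * (k * l2_rep F s))"
      unfolding l2_scale_def l2_mult_op_def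
      using l2_rep_class_AE[OF mult[OF f]]
      by (subst l2_class_eq_iff) (auto intro!: mult l2_funs_scale f l2_rep_in(2) l2_class_in)
    then show ?thesis
      unfolding l2_scale_def using l2_mult_op_class[OF h l2_funs_scale[OF f]] by simp
  qed
  have bound: "l2_norm M (l2_mult_op M h F) \<le> K * l2_norm M F" if F: "F \<in> l2_space M" for F
  proof -
    note f = l2_rep_in(2)[OF F]
    have "(\<integral>s. (h s * l2_rep F s)\<^sup>2 \<partial>M) \<le> (\<integral>s. K\<^sup>2 * (l2_rep F s)\<^sup>2 \<partial>M)"
    proof (rule integral_mono)
      fix s assume "s \<in> space M"
      then have "(h s)\<^sup>2 \<le> K\<^sup>2" using power_mono[of "\<bar>h s\<bar>" K 2] h(2) by simp
      then show "(h s * l2_rep F s)\<^sup>2 \<le> K\<^sup>2 * (l2_rep F s)\<^sup>2"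
        by (simp add: power_mult_distrib mult_right_mono)
    qed (use f mult[OF f] in \<open>auto simp: l2_funs_def\<close>)
    then have "sqrt (\<integral>s. (h s * l2_rep F s)\<^sup>2 \<partial>M) \<le> sqrt (K\<^sup>2 * (\<integral>s. (l2_rep F s)\<^sup>2 \<partial>M))"
      by simp
    then show ?thesis
      unfolding l2_mult_op_def l2_norm_class[OF mult[OF f]] using K
      by (simp add: l2_norm_def real_sqrt_mult)
  qed
  show ?thesis
    unfolding l2_bounded_linear_def using l2_mult_op_in[OF h] add scale bound by blast
qed

text \<open>By separability weak measurability suffices, and there the operator merely replaces the
  test function \<open>f\<close> by \<open>h * f\<close>.\<close>

lemma measurable_l2_mult_op:
  assumes sep: "separable_space (l2_topology M)"
    and h: "h \<in> borel_measurable M" "\<forall>s\<in>space M. \<bar>h s\<bar> \<le> K"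
    and \<xi>: "\<xi> \<in> measurable N (l2_borel M)"
  shows "(\<lambda>\<omega>. l2_mult_op M h (\<xi> \<omega>)) \<in> measurable N (l2_borel M)"
proof (rule measurable_l2_borelI[OF sep])
  have sp: "\<xi> \<omega> \<in> l2_space M" if "\<omega> \<in> space N" for \<omega>
    using measurable_space[OF \<xi> that] by (simp add: space_l2_borel)
  then show "l2_mult_op M h (\<xi> \<omega>) \<in> l2_space M" if "\<omega> \<in> space N" for \<omega>
    using that by (intro l2_mult_op_in[OF h]) auto
  fix f assume f: "f \<in> l2_funs M"
  have "(\<lambda>\<omega>. l2_inner M (\<xi> \<omega>) (\<lambda>s. h s * f s)) \<in> borel_measurable N"
    by (rule measurable_compose[OF \<xi> borel_measurable_l2_inner[OF l2_funs_mult_bounded[OF h f]]])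
  then show "(\<lambda>\<omega>. l2_inner M (l2_mult_op M h (\<xi> \<omega>)) f) \<in> borel_measurable N"
    using f sp by (subst measurable_cong[OF l2_inner_mult_op[OF h]]) (auto simp: l2_funs_def)
qed

text \<open>On the exceptional event the element is zero, so its inner product with \<open>f\<close>
  is the path integral cut off by an event. Joint measurability makes both the integral and the
  event measurable.\<close>

lemma measurable_l2_induced:
  assumes "sigma_finite_measure M" and sep: "separable_space (l2_topology M)"
    and Y[measurable]: "(\<lambda>(\<omega>, s). Y s \<omega>) \<in> borel_measurable (P \<Otimes>\<^sub>M M)"
  shows "l2_induced M Y \<in> measurable P (l2_borel M)"
proof (rule measurable_l2_borelI[OF sep])
  interpret sigma_finite_measure M by fact
  show "l2_induced M Y \<omega> \<in> l2_space M" for \<omega>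
    using l2_class_in l2_funs_zero by (auto simp: l2_induced_def)
  fix f assume "f \<in> l2_funs M"
  then have [measurable]: "f \<in> borel_measurable M" by (simp add: l2_funs_def)
  have sec: "(\<lambda>s. Y s \<omega>) \<in> borel_measurable M" if "\<omega> \<in> space P" for \<omega>
    using measurable_compose[OF measurable_Pair1'[OF that] Y] by simp
  have "l2_inner M (l2_induced M Y \<omega>) f = (if integrable M (\<lambda>s. (Y s \<omega>)\<^sup>2) then \<integral>s. Y s \<omega> * f s \<partial>M else 0)"
    if "\<omega> \<in> space P" for \<omega>
    using sec[OF that] l2_inner_class[of "\<lambda>s. Y s \<omega>" M f] l2_inner_class[OF l2_funs_zero, of f M]
    by (auto simp: l2_induced_def l2_funs_def)
  moreover have "(\<lambda>\<omega>. if integrable M (\<lambda>s. (Y s \<omega>)\<^sup>2) then \<integral>s. Y s \<omega> * f s \<partial>M else 0) \<in> borel_measurable P"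
    by measurable
  ultimately show "(\<lambda>\<omega>. l2_inner M (l2_induced M Y \<omega>) f) \<in> borel_measurable P"
    by (subst measurable_cong) auto
qed

section \<open>Closed linear spans of Gaussian variables\<close>

lemma (in prob_space) l2_imp_integrable: "f \<in> l2_funs M \<Longrightarrow> integrable M f"
  using square_integrable_imp_integrable unfolding l2_funs_def by blast

text \<open>This is the nonnegativity of the variance of the absolute value of
  \<open>f\<close>.\<close>

lemma (in prob_space) abs_expectation_le_sqrt:
  fixes f :: "'a \<Rightarrow> real"
  assumes [measurable]: "f \<in> borel_measurable M" and f2: "integrable M (\<lambda>x. (f x)\<^sup>2)"
  shows "(\<integral>x. \<bar>f x\<bar> \<partial>M) \<le> sqrt (\<integral>x. (f x)\<^sup>2 \<partial>M)"
proof -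
  have "integrable M (\<lambda>x. \<bar>f x\<bar>)"
    using square_integrable_imp_integrable[OF _ f2] by simp
  then have "0 \<le> (\<integral>x. (f x)\<^sup>2 \<partial>M) - (\<integral>x. \<bar>f x\<bar> \<partial>M)\<^sup>2"
    using variance_eq[of "\<lambda>x. \<bar>f x\<bar>"] f2 variance_positive[of "\<lambda>x. \<bar>f x\<bar>"] by simp
  then show ?thesis by (intro real_le_rsqrt) simp
qed

lemma abs_mult_le_squares: "\<bar>x * y\<bar> \<le> x\<^sup>2 + (y::real)\<^sup>2"
proof -
  have "2 * \<bar>x * y\<bar> \<le> x\<^sup>2 + y\<^sup>2"
    using sum_squares_bound[of "\<bar>x\<bar>" "\<bar>y\<bar>"] by (simp add: abs_mult)
  then show ?thesis by simp
qed

text \<open>The discriminant argument, with the optimal \<open>l = b / c\<close>. It is kept apart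
  from inner products because it is applied both to an exact Cauchy-Schwarz inequality and to
  near-minimisers, where \<open>e\<close> is only an error bound.\<close>

lemma power2_le_mult_if_quadratic_nonneg:
  fixes b c e :: real
  assumes "\<And>l. 2 * l * b \<le> e + l\<^sup>2 * c" "0 \<le> c"
  shows "b\<^sup>2 \<le> e * c"
proof (cases "c = 0")
  case True
  have "b = 0"
  proof (rule ccontr)
    assume "b \<noteq> 0"
    then show False using assms(1)[of "(e + 1) / (2 * b)"] True by simp
  qed
  then show ?thesis using True by simp
next
  case False
  with assms have c: "c > 0" by simp
  have "2 * (b / c) * b \<le> e + (b / c)\<^sup>2 * c" by (rule assms)
  then have "b\<^sup>2 / c \<le> e" using c by (simp add: power2_eq_square field_simps)
  then show ?thesis using c by (simp add: field_simps)
qed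

text \<open>Membership in the closed linear span of \<open>G\<close> in $L_2(P)$, in a weak form that needs neither
  completeness nor a projection and is stable under sums and integrals.\<close>

definition in_weak_span :: "'w measure \<Rightarrow> ('w \<Rightarrow> real) set \<Rightarrow> ('w \<Rightarrow> real) \<Rightarrow> bool" where
  "in_weak_span P G Z \<longleftrightarrow> Z \<in> l2_funs P \<and>
     (\<forall>W K. (\<forall>n::nat. W n \<in> l2_funs P \<and> (\<integral>\<omega>. (W n \<omega>)\<^sup>2 \<partial>P) \<le> K) \<longrightarrow>
        (\<forall>g\<in>G. (\<lambda>n. \<integral>\<omega>. W n \<omega> * g \<omega> \<partial>P) \<longlonglongrightarrow> 0) \<longrightarrow>
        (\<lambda>n. \<integral>\<omega>. W n \<omega> * Z \<omega> \<partial>P) \<longlonglongrightarrow> 0)"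

text \<open>Near-minimisers of the distance from \<open>Z\<close> to \<open>G\<close> are nearly orthogonal to \<open>G\<close>, hence to \<open>Z\<close>.\<close>

lemma in_weak_span_approx:
  assumes G: "G \<subseteq> l2_funs P" "G \<noteq> {}"
    and lin: "\<And>g h c. g \<in> G \<Longrightarrow> h \<in> G \<Longrightarrow> (\<lambda>\<omega>. g \<omega> + c * h \<omega>) \<in> G"
    and Z: "in_weak_span P G Z"
  shows "\<exists>g. (\<forall>n::nat. g n \<in> G) \<and> (\<lambda>n. \<integral>\<omega>. (Z \<omega> - g n \<omega>)\<^sup>2 \<partial>P) \<longlonglongrightarrow> 0 \<and>
    (\<lambda>n. \<integral>\<omega>. (g n \<omega>)\<^sup>2 \<partial>P) \<longlonglongrightarrow> (\<integral>\<omega>. (Z \<omega>)\<^sup>2 \<partial>P)"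
proof -
  define D where "D g = (\<integral>\<omega>. (Z \<omega> - g \<omega>)\<^sup>2 \<partial>P)" for g
  have Zl: "Z \<in> l2_funs P" using Z by (simp add: in_weak_span_def)
  have Wl: "(\<lambda>\<omega>. Z \<omega> - g \<omega>) \<in> l2_funs P" if "g \<in> G" for g
    using l2_funs_add[OF Zl l2_funs_scale[of g P "-1"]] that G by auto
  have D0: "0 \<le> D g" for g by (simp add: D_def)
  have bdd: "bdd_below (D ` G)" using D0 by (auto intro!: bdd_belowI[of _ 0])
  define \<delta> where "\<delta> = (INF g\<in>G. D g)"
  have \<delta>_le: "\<delta> \<le> D g" if "g \<in> G" for g
    unfolding \<delta>_def using bdd that by (rule cINF_lower)
  have "\<exists>g\<in>G. D g < \<delta> + 1 / Suc n" for n
    using cINF_less_iff[OF G(2) bdd, of "\<delta> + 1 / Suc n"] by (simp add: \<delta>_def)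
  then obtain g where g: "\<And>n. g n \<in> G" "\<And>n. D (g n) < \<delta> + 1 / Suc n" by metis
  define W where "W n \<omega> = Z \<omega> - g n \<omega>" for n \<omega>
  have W: "W n \<in> l2_funs P" for n unfolding W_def using Wl[OF g(1)] .
  have gl: "g n \<in> l2_funs P" for n using g(1) G by auto
  have e: "D (g n) - \<delta> < 1 / Suc n" for n using g(2)[of n] by simp
  have orth: "(\<integral>\<omega>. W n \<omega> * h \<omega> \<partial>P)\<^sup>2 \<le> 1 / Suc n * (\<integral>\<omega>. (h \<omega>)\<^sup>2 \<partial>P)" if h: "h \<in> G" for h n
  proof -
    have hl: "h \<in> l2_funs P" using h G by auto
    have "2 * l * (\<integral>\<omega>. W n \<omega> * h \<omega> \<partial>P) \<le> 1 / Suc n + l\<^sup>2 * (\<integral>\<omega>. (h \<omega>)\<^sup>2 \<partial>P)" for l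
    proof -
      \<comment> \<open>Moving from \<open>g n\<close> to \<open>g n + l * h\<close> stays in
        \<open>G\<close> and cannot lower the distance below \<open>\<delta>\<close>, so it gains
        less than \<open>1 / Suc n\<close> over \<open>D (g n)\<close>.\<close>
      have "\<delta> \<le> D (\<lambda>\<omega>. g n \<omega> + l * h \<omega>)" by (intro \<delta>_le lin g h)
      also have "\<dots> = (\<integral>\<omega>. (W n \<omega>)\<^sup>2 - 2 * l * (W n \<omega> * h \<omega>) + l\<^sup>2 * (h \<omega>)\<^sup>2 \<partial>P)"
        unfolding D_def W_def
        by (intro Bochner_Integration.integral_cong) (auto simp: power2_eq_square algebra_simps)
      also have "\<dots> = D (g n) - 2 * l * (\<integral>\<omega>. W n \<omega> * h \<omega> \<partial>P) + l\<^sup>2 * (\<integral>\<omega>. (h \<omega>)\<^sup>2 \<partial>P)"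
        using W[of n] hl l2_funs_mult_integrable[OF W[of n] hl]
        by (simp add: l2_funs_def D_def W_def[symmetric])
      finally show ?thesis using e[of n] by simp
    qed
    then show ?thesis by (rule power2_le_mult_if_quadratic_nonneg) simp
  qed
  have inv0: "(\<lambda>n. 1 / real (Suc n)) \<longlonglongrightarrow> 0"
    by (rule LIMSEQ_Suc[OF lim_inverse_n', unfolded inverse_eq_divide])
  have sq0: "(\<lambda>n. x n) \<longlonglongrightarrow> 0" if "\<And>n. (x n)\<^sup>2 \<le> 1 / Suc n * K" for x :: "nat \<Rightarrow> real" and K
  proof -
    have "(\<lambda>n. 1 / real (Suc n) * K) \<longlonglongrightarrow> 0" using tendsto_mult_left_zero[OF inv0] .
    then have "(\<lambda>n. (x n)\<^sup>2) \<longlonglongrightarrow> 0"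
      by (rule Lim_null_comparison[rotated]) (use that in auto)
    from tendsto_real_sqrt[OF this] show ?thesis by (simp add: tendsto_rabs_zero_iff)
  qed
  have Wb: "(\<integral>\<omega>. (W n \<omega>)\<^sup>2 \<partial>P) \<le> \<delta> + 1" for n
  proof -
    have "1 / real (Suc n) \<le> 1" by simp
    then show ?thesis using e[of n] unfolding D_def W_def[symmetric] by linarith
  qed
  \<comment> \<open>The residuals are themselves the test sequence in the definition of
    \<open>in_weak_span\<close>: bounded, and asymptotically orthogonal to \<open>G\<close>.\<close>
  have WZ: "(\<lambda>n. \<integral>\<omega>. W n \<omega> * Z \<omega> \<partial>P) \<longlonglongrightarrow> 0"
    using Z W Wb sq0[OF orth] unfolding in_weak_span_def by blast
  define A where "A = (\<integral>\<omega>. (Z \<omega>)\<^sup>2 \<partial>P)"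
  have gg: "(\<integral>\<omega>. (g n \<omega>)\<^sup>2 \<partial>P) = A - 2 * (\<integral>\<omega>. W n \<omega> * Z \<omega> \<partial>P) + (\<integral>\<omega>. (W n \<omega>)\<^sup>2 \<partial>P)" for n
  proof -
    have "(\<integral>\<omega>. (g n \<omega>)\<^sup>2 \<partial>P) = (\<integral>\<omega>. (Z \<omega>)\<^sup>2 - 2 * (W n \<omega> * Z \<omega>) + (W n \<omega>)\<^sup>2 \<partial>P)"
      unfolding W_def by (intro Bochner_Integration.integral_cong) (auto simp: power2_eq_square algebra_simps)
    also have "\<dots> = A - 2 * (\<integral>\<omega>. W n \<omega> * Z \<omega> \<partial>P) + (\<integral>\<omega>. (W n \<omega>)\<^sup>2 \<partial>P)"
      using W[of n] Zl l2_funs_mult_integrable[OF W[of n] Zl] by (simp add: l2_funs_def A_def)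
    finally show ?thesis .
  qed
  obtain B where B: "\<And>n. \<bar>\<integral>\<omega>. W n \<omega> * Z \<omega> \<partial>P\<bar> \<le> B"
    using convergent_imp_Bseq[OF convergentI[OF WZ]] by (auto simp: Bseq_def)
  have gb: "(\<integral>\<omega>. (g n \<omega>)\<^sup>2 \<partial>P) \<le> A + 2 * B + (\<delta> + 1)" for n
    using gg[of n] B[of n] Wb[of n] by (auto simp: abs_le_iff)
  \<comment> \<open>Here the element of \<open>G\<close> varies with \<open>n\<close>, so asymptotic
    orthogonality to each fixed element is not enough; the quantitative bound \<open>orth\<close>
    together with the bound \<open>gb\<close> on the norms is.\<close>
  have "(\<integral>\<omega>. W n \<omega> * g n \<omega> \<partial>P)\<^sup>2 \<le> 1 / Suc n * (A + 2 * B + (\<delta> + 1))" for n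
    using orth[OF g(1)[of n], of n] gb[of n] by (smt (verit) mult_left_mono divide_nonneg_nonneg of_nat_0_le_iff)
  then have Wg: "(\<lambda>n. \<integral>\<omega>. W n \<omega> * g n \<omega> \<partial>P) \<longlonglongrightarrow> 0" by (rule sq0)
  have WW: "(\<integral>\<omega>. (W n \<omega>)\<^sup>2 \<partial>P) = (\<integral>\<omega>. W n \<omega> * Z \<omega> \<partial>P) - (\<integral>\<omega>. W n \<omega> * g n \<omega> \<partial>P)" for n
    using l2_funs_mult_integrable[OF W[of n] Zl] l2_funs_mult_integrable[OF W[of n] gl]
    by (subst Bochner_Integration.integral_diff[symmetric]) (auto simp: W_def power2_eq_square algebra_simps)
  have W0: "(\<lambda>n. \<integral>\<omega>. (W n \<omega>)\<^sup>2 \<partial>P) \<longlonglongrightarrow> 0"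
    unfolding WW using tendsto_diff[OF WZ Wg] by simp
  show ?thesis
  proof (intro exI[of _ g] conjI allI)
    show "g n \<in> G" for n by (rule g)
    show "(\<lambda>n. \<integral>\<omega>. (Z \<omega> - g n \<omega>)\<^sup>2 \<partial>P) \<longlonglongrightarrow> 0" using W0 by (simp add: W_def)
    show "(\<lambda>n. \<integral>\<omega>. (g n \<omega>)\<^sup>2 \<partial>P) \<longlonglongrightarrow> (\<integral>\<omega>. (Z \<omega>)\<^sup>2 \<partial>P)"
      unfolding gg using tendsto_add[OF tendsto_diff[OF tendsto_const tendsto_mult_left[OF WZ, of 2]] W0, of A]
      by (simp add: A_def)
  qed
qed

section \<open>Characteristic functions of centred Gaussian variables and their limits\<close>

lemma norm_iexp_diff_le: "norm (iexp x - iexp y) \<le> \<bar>x - y\<bar>"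
proof -
  have "iexp x = iexp y * iexp (x - y)"
    unfolding exp_add[symmetric] by (simp add: ring_distribs)
  then have "iexp x - iexp y = iexp y * (iexp (x - y) - 1)"
    by (simp add: ring_distribs)
  also have "norm \<dots> = norm (iexp (x - y) - 1)" by (simp add: norm_mult)
  also have "\<dots> \<le> \<bar>x - y\<bar>" using iexp_approx1[of "x - y" 0] by simp
  finally show ?thesis .
qed

text \<open>Both sides of the Gaussian formula are continuous along the approximating sequence:
  \<open>iexp\<close> is 1-Lipschitz, so the left sides differ by at most the L2 distance, and the
  second moments converge as well.\<close>

lemma (in prob_space) char_in_weak_span:
  assumes G: "G \<subseteq> l2_funs M" "G \<noteq> {}"
    and lin: "\<And>g h c. g \<in> G \<Longrightarrow> h \<in> G \<Longrightarrow> (\<lambda>\<omega>. g \<omega> + c * h \<omega>) \<in> G"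
    and gauss: "\<And>g. g \<in> G \<Longrightarrow> (CLINT \<omega>|M. iexp (g \<omega>)) = exp (- (\<integral>\<omega>. (g \<omega>)\<^sup>2 \<partial>M) / 2)"
    and Z: "in_weak_span M G Z"
  shows "(CLINT \<omega>|M. iexp (Z \<omega>)) = exp (- (\<integral>\<omega>. (Z \<omega>)\<^sup>2 \<partial>M) / 2)"
proof -
  have "\<exists>g. (\<forall>n::nat. g n \<in> G) \<and> (\<lambda>n. \<integral>\<omega>. (Z \<omega> - g n \<omega>)\<^sup>2 \<partial>M) \<longlonglongrightarrow> 0 \<and>
    (\<lambda>n. \<integral>\<omega>. (g n \<omega>)\<^sup>2 \<partial>M) \<longlonglongrightarrow> (\<integral>\<omega>. (Z \<omega>)\<^sup>2 \<partial>M)"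
    by (rule in_weak_span_approx[OF G _ Z]) (rule lin)
  then obtain g where g: "\<And>n::nat. g n \<in> G" and D: "(\<lambda>n. \<integral>\<omega>. (Z \<omega> - g n \<omega>)\<^sup>2 \<partial>M) \<longlonglongrightarrow> 0"
    and V: "(\<lambda>n. \<integral>\<omega>. (g n \<omega>)\<^sup>2 \<partial>M) \<longlonglongrightarrow> (\<integral>\<omega>. (Z \<omega>)\<^sup>2 \<partial>M)"
    by blast
  have Zl: "Z \<in> l2_funs M" using Z by (simp add: in_weak_span_def)
  have gl: "g n \<in> l2_funs M" for n using g G by auto
  have [measurable]: "Z \<in> borel_measurable M" "g n \<in> borel_measurable M" for n
    using Zl gl by (auto simp: l2_funs_def)
  have int: "integrable M (\<lambda>\<omega>. iexp (Y \<omega>))" if [measurable]: "Y \<in> borel_measurable M" for Y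
    by (rule integrable_const_bound[of _ 1]) auto
  have le: "norm ((CLINT \<omega>|M. iexp (g n \<omega>)) - (CLINT \<omega>|M. iexp (Z \<omega>))) \<le> sqrt (\<integral>\<omega>. (Z \<omega> - g n \<omega>)\<^sup>2 \<partial>M)" for n
  proof -
    have W: "(\<lambda>\<omega>. Z \<omega> - g n \<omega>) \<in> l2_funs M"
      using l2_funs_add[OF Zl l2_funs_scale[OF gl[of n], of "-1"]] by simp
    have intd: "integrable M (\<lambda>\<omega>. iexp (g n \<omega>) - iexp (Z \<omega>))"
      by (rule Bochner_Integration.integrable_diff[OF int int]) measurable
    have "(CLINT \<omega>|M. iexp (g n \<omega>)) - (CLINT \<omega>|M. iexp (Z \<omega>)) = (CLINT \<omega>|M. iexp (g n \<omega>) - iexp (Z \<omega>))"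
      by (rule Bochner_Integration.integral_diff[symmetric, OF int int]) measurable
    also have "norm \<dots> \<le> (\<integral>\<omega>. norm (iexp (g n \<omega>) - iexp (Z \<omega>)) \<partial>M)"
      by (rule integral_norm_bound)
    also have "\<dots> \<le> (\<integral>\<omega>. \<bar>Z \<omega> - g n \<omega>\<bar> \<partial>M)"
    proof (rule integral_mono)
      show "integrable M (\<lambda>\<omega>. norm (iexp (g n \<omega>) - iexp (Z \<omega>)))"
        using intd by (rule integrable_norm)
      have "integrable M (\<lambda>\<omega>. Z \<omega> - g n \<omega>)" using W by (rule l2_imp_integrable)
      then show "integrable M (\<lambda>\<omega>. \<bar>Z \<omega> - g n \<omega>\<bar>)" by (rule integrable_abs)
      show "norm (iexp (g n \<omega>) - iexp (Z \<omega>)) \<le> \<bar>Z \<omega> - g n \<omega>\<bar>" for \<omega>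
        by (subst abs_minus_commute) (rule norm_iexp_diff_le)
    qed
    also have "\<dots> \<le> sqrt (\<integral>\<omega>. (Z \<omega> - g n \<omega>)\<^sup>2 \<partial>M)"
      using W by (intro abs_expectation_le_sqrt) (auto simp: l2_funs_def)
    finally show ?thesis .
  qed
  have "(\<lambda>n. sqrt (\<integral>\<omega>. (Z \<omega> - g n \<omega>)\<^sup>2 \<partial>M)) \<longlonglongrightarrow> 0"
    using tendsto_real_sqrt[OF D] by (simp only: real_sqrt_zero)
  then have "(\<lambda>n. (CLINT \<omega>|M. iexp (g n \<omega>)) - (CLINT \<omega>|M. iexp (Z \<omega>))) \<longlonglongrightarrow> 0"
    by (rule Lim_null_comparison[OF always_eventually, rotated]) (intro allI le)
  then have "(\<lambda>n. CLINT \<omega>|M. iexp (g n \<omega>)) \<longlonglongrightarrow> (CLINT \<omega>|M. iexp (Z \<omega>))"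
    by (rule LIM_zero_cancel)
  moreover have "(\<lambda>n. complex_of_real (exp (- (\<integral>\<omega>. (g n \<omega>)\<^sup>2 \<partial>M) / 2)))
      \<longlonglongrightarrow> complex_of_real (exp (- (\<integral>\<omega>. (Z \<omega>)\<^sup>2 \<partial>M) / 2))"
    by (rule tendsto_of_real[OF tendsto_exp[OF tendsto_divide[OF tendsto_minus[OF V] tendsto_const]]]) simp
  ultimately show ?thesis
    unfolding gauss[OF g] by (rule LIMSEQ_unique)
qed

lemma (in prob_space) gaussian_rv_l2:
  assumes "gaussian_rv M Y"
  shows "Y \<in> l2_funs M"
proof -
  have [measurable]: "Y \<in> borel_measurable M" using assms by (simp add: gaussian_rv_def)
  have const: "(\<lambda>_. m) \<in> l2_funs M" for m by (simp add: l2_funs_def)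
  consider m where "distr M borel Y = return borel m"
    | m v where "0 < v" "distributed M lborel Y (normal_density m v)"
    using assms by (auto simp: gaussian_rv_def)
  then show ?thesis
  proof cases
    case 1
    have "AE x in distr M borel Y. x = m" unfolding 1 by (simp add: AE_return)
    then have "AE \<omega> in M. Y \<omega> = m" by (simp add: AE_distr_iff)
    then have "integrable M (\<lambda>\<omega>. (Y \<omega>)\<^sup>2) \<longleftrightarrow> integrable M (\<lambda>\<omega>. m\<^sup>2)"
      by (intro integrable_cong_AE) auto
    then show ?thesis by (simp add: l2_funs_def)
  next
    case 2
    have "integrable M (\<lambda>\<omega>. (Y \<omega> - m)\<^sup>2)"
      using distributed_integrable[OF 2(2), of "\<lambda>x. (x - m)\<^sup>2"] integrable_normal_moment[OF 2(1), of m 2]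
      by simp
    then have "(\<lambda>\<omega>. Y \<omega> - m) \<in> l2_funs M" by (simp add: l2_funs_def)
    from l2_funs_add[OF this const[of m]] show ?thesis by simp
  qed
qed

text \<open>A centred point mass sits at 0, where both sides equal 1. In the normal case
  \<open>v\<close> is the standard deviation; the characteristic function is that of the standard
  normal variable \<open>Y / v\<close> at the frequency \<open>v\<close>.\<close>

lemma (in prob_space) char_gaussian_rv:
  assumes Y: "gaussian_rv M Y" and mean: "(\<integral>\<omega>. Y \<omega> \<partial>M) = 0"
  shows "(CLINT \<omega>|M. iexp (Y \<omega>)) = exp (- (\<integral>\<omega>. (Y \<omega>)\<^sup>2 \<partial>M) / 2)"
proof -
  have [measurable]: "Y \<in> borel_measurable M" using Y by (simp add: gaussian_rv_def)
  consider m where "distr M borel Y = return borel m"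
    | m v where "0 < v" "distributed M lborel Y (normal_density m v)"
    using Y by (auto simp: gaussian_rv_def)
  then show ?thesis
  proof cases
    case 1
    have "AE x in distr M borel Y. x = m" unfolding 1 by (simp add: AE_return)
    then have ae: "AE \<omega> in M. Y \<omega> = m" by (simp add: AE_distr_iff)
    have "(\<integral>\<omega>. Y \<omega> \<partial>M) = (\<integral>\<omega>. m \<partial>M)"
      using ae by (intro integral_cong_AE) auto
    then have m: "m = 0" using mean prob_space by simp
    have "(CLINT \<omega>|M. iexp (Y \<omega>)) = (CLINT \<omega>|M. iexp 0)"
      using ae by (intro integral_cong_AE) (auto simp: m)
    moreover have "(\<integral>\<omega>. (Y \<omega>)\<^sup>2 \<partial>M) = (\<integral>\<omega>. 0\<^sup>2 \<partial>M)"
      using ae by (intro integral_cong_AE) (auto simp: m)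
    ultimately show ?thesis using prob_space by simp
  next
    case 2
    have m: "m = 0"
      using normal_distributed_expectation[OF 2] mean by simp
    have var: "(\<integral>\<omega>. (Y \<omega>)\<^sup>2 \<partial>M) = v\<^sup>2"
      using normal_distributed_variance[OF 2] mean by simp
    have "distributed M lborel (\<lambda>\<omega>. Y \<omega> / v) std_normal_density"
      using normal_standard_normal_convert[OF 2(1), of Y m] 2(2) by (simp add: m)
    then have D: "distr M lborel (\<lambda>\<omega>. Y \<omega> / v) = std_normal_distribution"
      by (rule distributed_distr_eq_density)
    have "(CLINT x|distr M lborel (\<lambda>\<omega>. Y \<omega> / v). iexp (v * x)) = (CLINT \<omega>|M. iexp (v * (Y \<omega> / v)))"
      by (rule integral_distr) auto
    also have "(\<lambda>\<omega>. v * (Y \<omega> / v)) = Y" using 2(1) by auto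
    finally have "(CLINT \<omega>|M. iexp (Y \<omega>)) = char std_normal_distribution v"
      using 2(1) by (simp add: D char_def)
    then show ?thesis by (simp add: var char_std_normal_distribution)
  qed
qed

section \<open>Finite linear combinations and stability of the weak span\<close>

definition rv_span :: "'i set \<Rightarrow> ('i \<Rightarrow> 'w \<Rightarrow> real) \<Rightarrow> ('w \<Rightarrow> real) set" where
  "rv_span I Z = {\<lambda>\<omega>. \<Sum>i\<in>J. k i * Z i \<omega> |J k. finite J \<and> J \<subseteq> I}"

lemma rv_span_base: "i \<in> I \<Longrightarrow> Z i \<in> rv_span I Z"
  unfolding rv_span_def by (auto intro!: exI[of _ "{i}"] exI[of _ "\<lambda>_. 1"])

lemma rv_span_add_scale:
  assumes "g \<in> rv_span I Z" "h \<in> rv_span I Z"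
  shows "(\<lambda>\<omega>. g \<omega> + c * h \<omega>) \<in> rv_span I Z"
proof -
  obtain J k where g: "g = (\<lambda>\<omega>. \<Sum>i\<in>J. k i * Z i \<omega>)" "finite J" "J \<subseteq> I"
    using assms(1) by (auto simp: rv_span_def)
  obtain J' k' where h: "h = (\<lambda>\<omega>. \<Sum>i\<in>J'. k' i * Z i \<omega>)" "finite J'" "J' \<subseteq> I"
    using assms(2) by (auto simp: rv_span_def)
  \<comment> \<open>The coefficients are cut to zero outside \<open>J\<close> and \<open>J'\<close>,
    as \<open>k\<close> and \<open>k'\<close> may take any value there.\<close>
  define l where "l i = (if i \<in> J then k i else 0) + c * (if i \<in> J' then k' i else 0)" for i
  have "(\<Sum>i\<in>J. k i * Z i \<omega>) = (\<Sum>i\<in>J \<union> J'. (if i \<in> J then k i else 0) * Z i \<omega>)" for \<omega>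
    using g h by (intro sum.mono_neutral_cong_left) auto
  moreover have "(\<Sum>i\<in>J'. k' i * Z i \<omega>) = (\<Sum>i\<in>J \<union> J'. (if i \<in> J' then k' i else 0) * Z i \<omega>)" for \<omega>
    using g h by (intro sum.mono_neutral_cong_left) auto
  ultimately have "g \<omega> + c * h \<omega> = (\<Sum>i\<in>J \<union> J'. l i * Z i \<omega>)" for \<omega>
    by (simp add: g h l_def sum_distrib_left sum.distrib[symmetric] algebra_simps)
  then have "(\<lambda>\<omega>. g \<omega> + c * h \<omega>) = (\<lambda>\<omega>. \<Sum>i\<in>J \<union> J'. l i * Z i \<omega>)" by auto
  moreover have "finite (J \<union> J')" "J \<union> J' \<subseteq> I" using g h by auto
  ultimately show ?thesis unfolding rv_span_def by blast
qed

lemma gaussian_process_span: "gaussian_process P I Z \<Longrightarrow> g \<in> rv_span I Z \<Longrightarrow> gaussian_rv P g"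
  by (auto simp: gaussian_process_def rv_span_def)

lemma (in prob_space) expectation_rv_span:
  assumes "gaussian_process M I Z" "\<And>i. i \<in> I \<Longrightarrow> (\<integral>\<omega>. Z i \<omega> \<partial>M) = 0" "g \<in> rv_span I Z"
  shows "(\<integral>\<omega>. g \<omega> \<partial>M) = 0"
proof -
  obtain J k where g: "g = (\<lambda>\<omega>. \<Sum>i\<in>J. k i * Z i \<omega>)" "finite J" "J \<subseteq> I"
    using assms(3) by (auto simp: rv_span_def)
  have "integrable M (Z i)" if "i \<in> J" for i
  proof -
    have "Z i \<in> l2_funs M"
      using gaussian_rv_l2[OF gaussian_process_span[OF assms(1) rv_span_base]] that g by auto
    then show ?thesis by (rule l2_imp_integrable)
  qed
  then show ?thesis
    using assms(2) g by (simp add: subset_iff)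
qed

lemma in_weak_span_zero: "in_weak_span P G (\<lambda>_. 0)"
  by (simp add: in_weak_span_def l2_funs_def)

lemma in_weak_span_add:
  assumes "in_weak_span P G Y" "in_weak_span P G Z"
  shows "in_weak_span P G (\<lambda>\<omega>. Y \<omega> + Z \<omega>)"
  unfolding in_weak_span_def
proof (intro conjI allI impI)
  have YZ: "Y \<in> l2_funs P" "Z \<in> l2_funs P" using assms by (auto simp: in_weak_span_def)
  then show "(\<lambda>\<omega>. Y \<omega> + Z \<omega>) \<in> l2_funs P" by (rule l2_funs_add)
  fix W K
  assume W: "\<forall>n::nat. W n \<in> l2_funs P \<and> (\<integral>\<omega>. (W n \<omega>)\<^sup>2 \<partial>P) \<le> K"
    and lim: "\<forall>g\<in>G. (\<lambda>n. \<integral>\<omega>. W n \<omega> * g \<omega> \<partial>P) \<longlonglongrightarrow> 0"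
  have "(\<lambda>n. (\<integral>\<omega>. W n \<omega> * Y \<omega> \<partial>P) + (\<integral>\<omega>. W n \<omega> * Z \<omega> \<partial>P)) \<longlonglongrightarrow> 0 + 0"
  proof (rule tendsto_add)
    show "(\<lambda>n. \<integral>\<omega>. W n \<omega> * Y \<omega> \<partial>P) \<longlonglongrightarrow> 0"
      using assms(1) W lim unfolding in_weak_span_def by blast
    show "(\<lambda>n. \<integral>\<omega>. W n \<omega> * Z \<omega> \<partial>P) \<longlonglongrightarrow> 0"
      using assms(2) W lim unfolding in_weak_span_def by blast
  qed
  moreover have "(\<integral>\<omega>. W n \<omega> * (Y \<omega> + Z \<omega>) \<partial>P) = (\<integral>\<omega>. W n \<omega> * Y \<omega> \<partial>P) + (\<integral>\<omega>. W n \<omega> * Z \<omega> \<partial>P)" for n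
    using W YZ l2_funs_mult_integrable[of "W n" P Y] l2_funs_mult_integrable[of "W n" P Z]
    by (simp add: distrib_left)
  ultimately show "(\<lambda>n. \<integral>\<omega>. W n \<omega> * (Y \<omega> + Z \<omega>) \<partial>P) \<longlonglongrightarrow> 0" by simp
qed

lemma in_weak_span_sum:
  "(\<And>j. j \<in> J \<Longrightarrow> in_weak_span P G (Z j)) \<Longrightarrow> in_weak_span P G (\<lambda>\<omega>. \<Sum>j\<in>J. Z j \<omega>)"
  by (induction J rule: infinite_finite_induct) (auto intro: in_weak_span_zero in_weak_span_add)

section \<open>Integrals of a measurable random field\<close>

lemma l2_cauchy_schwarz:
  assumes f: "f \<in> l2_funs M" and g: "g \<in> l2_funs M"
  shows "(\<integral>s. f s * g s \<partial>M)\<^sup>2 \<le> (\<integral>s. (f s)\<^sup>2 \<partial>M) * (\<integral>s. (g s)\<^sup>2 \<partial>M)"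
proof (rule power2_le_mult_if_quadratic_nonneg)
  fix l
  have "0 \<le> (\<integral>s. (f s - l * g s)\<^sup>2 \<partial>M)" by simp
  also have "\<dots> = (\<integral>s. (f s)\<^sup>2 - 2 * l * (f s * g s) + l\<^sup>2 * (g s)\<^sup>2 \<partial>M)"
    by (intro Bochner_Integration.integral_cong) (auto simp: power2_eq_square algebra_simps)
  also have "\<dots> = (\<integral>s. (f s)\<^sup>2 \<partial>M) - 2 * l * (\<integral>s. f s * g s \<partial>M) + l\<^sup>2 * (\<integral>s. (g s)\<^sup>2 \<partial>M)"
    using f g l2_funs_mult_integrable[OF f g] by (simp add: l2_funs_def)
  finally show "2 * l * (\<integral>s. f s * g s \<partial>M) \<le> (\<integral>s. (f s)\<^sup>2 \<partial>M) + l\<^sup>2 * (\<integral>s. (g s)\<^sup>2 \<partial>M)" by simp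
qed simp

text \<open>One time slice of the process. The assumption \<open>var\<close> makes it an element of
  L2 of the product of \<open>P\<close> and \<open>M\<close>.\<close>

locale measurable_l2_field = P: prob_space P + M: sigma_finite_measure M
  for P :: "'w measure" and M :: "'s measure" +
  fixes Y :: "'s \<Rightarrow> 'w \<Rightarrow> real"
  assumes Y[measurable]: "(\<lambda>(\<omega>, s). Y s \<omega>) \<in> borel_measurable (P \<Otimes>\<^sub>M M)"
    and Y_l2: "\<And>s. s \<in> space M \<Longrightarrow> Y s \<in> l2_funs P"
    and var: "integrable M (\<lambda>s. \<integral>\<omega>. (Y s \<omega>)\<^sup>2 \<partial>P)"
begin

sublocale PM: pair_sigma_finite P M ..

text \<open>In \<open>var\<close> the integral over \<open>P\<close> is the inner one, so Fubini's
  criterion is applied on \<open>M \<Otimes>\<^sub>M P\<close> and the factors are swapped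
  afterwards.\<close>

lemma integrable_square: "integrable (P \<Otimes>\<^sub>M M) (\<lambda>(\<omega>, s). (Y s \<omega>)\<^sup>2)"
proof -
  interpret MP: pair_sigma_finite M P ..
  have "integrable (M \<Otimes>\<^sub>M P) (\<lambda>(s, \<omega>). (Y s \<omega>)\<^sup>2)"
  proof (rule MP.Fubini_integrable)
    have "(\<lambda>(\<omega>, s). (Y s \<omega>)\<^sup>2) \<in> borel_measurable (P \<Otimes>\<^sub>M M)" by measurable
    from measurable_pair_swap[OF this]
    show "(\<lambda>(s, \<omega>). (Y s \<omega>)\<^sup>2) \<in> borel_measurable (M \<Otimes>\<^sub>M P)" by simp
    show "integrable M (\<lambda>s. \<integral>\<omega>. norm (case (s, \<omega>) of (s, \<omega>) \<Rightarrow> (Y s \<omega>)\<^sup>2) \<partial>P)"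
      using var by simp
    show "AE s in M. integrable P (\<lambda>\<omega>. case (s, \<omega>) of (s, \<omega>) \<Rightarrow> (Y s \<omega>)\<^sup>2)"
      using Y_l2 by (auto simp: l2_funs_def)
  qed
  from MP.integrable_product_swap[OF this] show ?thesis by simp
qed

lemma section_measurable: "\<omega> \<in> space P \<Longrightarrow> (\<lambda>s. Y s \<omega>) \<in> borel_measurable M"
  using measurable_compose[OF measurable_Pair1' Y] by simp

lemma AE_paths_l2: "AE \<omega> in P. (\<lambda>s. Y s \<omega>) \<in> l2_funs M"
  using PM.AE_integrable_fst[OF integrable_square] section_measurable
  by (auto simp: l2_funs_def elim!: AE_mp intro!: AE_I2)

text \<open>The factors are grouped as \<open>W * f\<close> against \<open>Y\<close>: the square of
  the former is integrable because its variables separate, that of the latter by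
  \<open>integrable_square\<close>.\<close>

lemma integrable_triple:
  assumes W: "W \<in> l2_funs P" and f: "f \<in> l2_funs M"
  shows "integrable (P \<Otimes>\<^sub>M M) (\<lambda>(\<omega>, s). W \<omega> * (Y s \<omega> * f s))"
proof -
  have [measurable]: "W \<in> borel_measurable P" "f \<in> borel_measurable M"
    using W f by (auto simp: l2_funs_def)
  have Wf: "integrable (P \<Otimes>\<^sub>M M) (\<lambda>(\<omega>, s). (W \<omega>)\<^sup>2 * (f s)\<^sup>2)"
    by (rule PM.Fubini_integrable) (use W f in \<open>auto simp: l2_funs_def abs_mult\<close>)
  have sum: "integrable (P \<Otimes>\<^sub>M M) (\<lambda>x. (case x of (\<omega>, s) \<Rightarrow> (W \<omega>)\<^sup>2 * (f s)\<^sup>2) + (case x of (\<omega>, s) \<Rightarrow> (Y s \<omega>)\<^sup>2))"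
    by (rule Bochner_Integration.integrable_add[OF Wf integrable_square])
  show ?thesis
  proof (rule Bochner_Integration.integrable_bound[OF sum])
    show "(\<lambda>(\<omega>, s). W \<omega> * (Y s \<omega> * f s)) \<in> borel_measurable (P \<Otimes>\<^sub>M M)" by measurable
    have "\<bar>W \<omega> * (Y s \<omega> * f s)\<bar> \<le> (W \<omega>)\<^sup>2 * (f s)\<^sup>2 + (Y s \<omega>)\<^sup>2" for \<omega> s
      using abs_mult_le_squares[of "W \<omega> * f s" "Y s \<omega>"] by (simp add: power_mult_distrib ac_simps)
    then show "AE x in P \<Otimes>\<^sub>M M. norm (case x of (\<omega>, s) \<Rightarrow> W \<omega> * (Y s \<omega> * f s)) \<le>
        norm ((case x of (\<omega>, s) \<Rightarrow> (W \<omega>)\<^sup>2 * (f s)\<^sup>2) + (case x of (\<omega>, s) \<Rightarrow> (Y s \<omega>)\<^sup>2))"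
      by (intro AE_I2) (auto simp: split_beta)
  qed
qed

text \<open>Leaving \<open>W\<close> arbitrary lets one exchange of integrals serve both the weak
  span and the covariances.\<close>

lemma expectation_times_integral:
  assumes W: "W \<in> l2_funs P" and f: "f \<in> l2_funs M"
  shows "(\<integral>\<omega>. W \<omega> * (\<integral>s. Y s \<omega> * f s \<partial>M) \<partial>P) = (\<integral>s. f s * (\<integral>\<omega>. W \<omega> * Y s \<omega> \<partial>P) \<partial>M)"
proof -
  have "(\<integral>\<omega>. W \<omega> * (\<integral>s. Y s \<omega> * f s \<partial>M) \<partial>P) = (\<integral>\<omega>. (\<integral>s. W \<omega> * (Y s \<omega> * f s) \<partial>M) \<partial>P)"
    by simp
  also have "\<dots> = (\<integral>s. (\<integral>\<omega>. W \<omega> * (Y s \<omega> * f s) \<partial>P) \<partial>M)"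
    by (rule PM.Fubini_integral[symmetric]) (rule integrable_triple[OF assms])
  also have "\<dots> = (\<integral>s. (\<integral>\<omega>. f s * (W \<omega> * Y s \<omega>) \<partial>P) \<partial>M)"
    by (simp only: ac_simps)
  finally show ?thesis by simp
qed

text \<open>Cauchy-Schwarz path by path, which is available for almost every path, followed by
  integration over \<open>P\<close>.\<close>

lemma integral_l2:
  assumes f: "f \<in> l2_funs M"
  shows "(\<lambda>\<omega>. \<integral>s. Y s \<omega> * f s \<partial>M) \<in> l2_funs P"
proof -
  have [measurable]: "f \<in> borel_measurable M" using f by (auto simp: l2_funs_def)
  have meas: "(\<lambda>\<omega>. \<integral>s. Y s \<omega> * f s \<partial>M) \<in> borel_measurable P" by measurable
  have "integrable P (\<lambda>\<omega>. (\<integral>s. (Y s \<omega>)\<^sup>2 \<partial>M) * (\<integral>s. (f s)\<^sup>2 \<partial>M))"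
    using PM.integrable_fst[OF integrable_square] by simp
  then have "integrable P (\<lambda>\<omega>. (\<integral>s. Y s \<omega> * f s \<partial>M)\<^sup>2)"
  proof (rule Bochner_Integration.integrable_bound)
    show "(\<lambda>\<omega>. (\<integral>s. Y s \<omega> * f s \<partial>M)\<^sup>2) \<in> borel_measurable P" using meas by measurable
    show "AE \<omega> in P. norm ((\<integral>s. Y s \<omega> * f s \<partial>M)\<^sup>2) \<le> norm ((\<integral>s. (Y s \<omega>)\<^sup>2 \<partial>M) * (\<integral>s. (f s)\<^sup>2 \<partial>M))"
      using AE_paths_l2
    proof eventually_elim
      case (elim \<omega>)
      then show ?case using l2_cauchy_schwarz[OF elim f] by simp
    qed
  qed
  then show ?thesis using meas by (simp add: l2_funs_def)
qed

text \<open>Fubini reduces the claim to integrals over \<open>s\<close> of \<open>f s\<close> times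
  the pairing of \<open>W n\<close> with \<open>Y s\<close>, which tends to 0 for each
  \<open>s\<close>. The common bound \<open>K\<close> on the second moments of \<open>W n\<close>
  provides a dominating function that does not depend on \<open>n\<close>.\<close>

lemma integral_in_weak_span:
  assumes f: "f \<in> l2_funs M" and G: "\<And>s. s \<in> space M \<Longrightarrow> Y s \<in> G"
  shows "in_weak_span P G (\<lambda>\<omega>. \<integral>s. Y s \<omega> * f s \<partial>M)"
  unfolding in_weak_span_def
proof (intro conjI allI impI)
  show "(\<lambda>\<omega>. \<integral>s. Y s \<omega> * f s \<partial>M) \<in> l2_funs P" by (rule integral_l2[OF f])
  fix W K
  assume W: "\<forall>n::nat. W n \<in> l2_funs P \<and> (\<integral>\<omega>. (W n \<omega>)\<^sup>2 \<partial>P) \<le> K"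
    and lim: "\<forall>g\<in>G. (\<lambda>n. \<integral>\<omega>. W n \<omega> * g \<omega> \<partial>P) \<longlonglongrightarrow> 0"
  have [measurable]: "f \<in> borel_measurable M" using f by (auto simp: l2_funs_def)
  have "(\<lambda>n. \<integral>s. f s * (\<integral>\<omega>. W n \<omega> * Y s \<omega> \<partial>P) \<partial>M) \<longlonglongrightarrow> (\<integral>s. 0 \<partial>M)"
  proof (rule integral_dominated_convergence)
    show "integrable M (\<lambda>s. K * (f s)\<^sup>2 + (\<integral>\<omega>. (Y s \<omega>)\<^sup>2 \<partial>P))"
      using f var by (simp add: l2_funs_def)
    show "(\<lambda>s. f s * (\<integral>\<omega>. W n \<omega> * Y s \<omega> \<partial>P)) \<in> borel_measurable M" for n
    proof -
      have [measurable]: "W n \<in> borel_measurable P" using W by (simp add: l2_funs_def)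
      have "(\<lambda>(\<omega>, s). W n \<omega> * Y s \<omega>) \<in> borel_measurable (P \<Otimes>\<^sub>M M)" by measurable
      from measurable_pair_swap[OF this]
      have [measurable]: "(\<lambda>(s, \<omega>). W n \<omega> * Y s \<omega>) \<in> borel_measurable (M \<Otimes>\<^sub>M P)" by simp
      show ?thesis by measurable
    qed
    show "AE s in M. (\<lambda>n. f s * (\<integral>\<omega>. W n \<omega> * Y s \<omega> \<partial>P)) \<longlonglongrightarrow> 0"
      using lim G by (intro AE_I2 tendsto_mult_right_zero) auto
    show "AE s in M. norm (f s * (\<integral>\<omega>. W n \<omega> * Y s \<omega> \<partial>P)) \<le> K * (f s)\<^sup>2 + (\<integral>\<omega>. (Y s \<omega>)\<^sup>2 \<partial>P)" for n
    proof (rule AE_I2)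
      fix s assume s: "s \<in> space M"
      have Wn: "W n \<in> l2_funs P" using W by blast
      have "norm (f s * (\<integral>\<omega>. W n \<omega> * Y s \<omega> \<partial>P)) = norm (\<integral>\<omega>. f s * W n \<omega> * Y s \<omega> \<partial>P)"
        by (simp add: mult.assoc)
      also have "\<dots> \<le> (\<integral>\<omega>. \<bar>f s * W n \<omega> * Y s \<omega>\<bar> \<partial>P)"
        using integral_norm_bound[of P "\<lambda>\<omega>. f s * W n \<omega> * Y s \<omega>"] by simp
      also have "\<dots> \<le> (\<integral>\<omega>. (f s)\<^sup>2 * (W n \<omega>)\<^sup>2 + (Y s \<omega>)\<^sup>2 \<partial>P)"
      proof (rule integral_mono)
        show "integrable P (\<lambda>\<omega>. \<bar>f s * W n \<omega> * Y s \<omega>\<bar>)"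
          using l2_funs_mult_integrable[OF l2_funs_scale[OF Wn, of "f s"] Y_l2[OF s]] by (rule integrable_abs)
        show "integrable P (\<lambda>\<omega>. (f s)\<^sup>2 * (W n \<omega>)\<^sup>2 + (Y s \<omega>)\<^sup>2)"
          using Wn Y_l2[OF s] by (simp add: l2_funs_def)
        show "\<bar>f s * W n \<omega> * Y s \<omega>\<bar> \<le> (f s)\<^sup>2 * (W n \<omega>)\<^sup>2 + (Y s \<omega>)\<^sup>2" for \<omega>
          using abs_mult_le_squares[of "f s * W n \<omega>" "Y s \<omega>"] by (simp add: power_mult_distrib)
      qed
      also have "\<dots> = (f s)\<^sup>2 * (\<integral>\<omega>. (W n \<omega>)\<^sup>2 \<partial>P) + (\<integral>\<omega>. (Y s \<omega>)\<^sup>2 \<partial>P)"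
        using Wn Y_l2[OF s] by (simp add: l2_funs_def)
      also have "\<dots> \<le> (f s)\<^sup>2 * K + (\<integral>\<omega>. (Y s \<omega>)\<^sup>2 \<partial>P)"
        using W by (intro add_right_mono mult_left_mono) auto
      finally show "norm (f s * (\<integral>\<omega>. W n \<omega> * Y s \<omega> \<partial>P)) \<le> K * (f s)\<^sup>2 + (\<integral>\<omega>. (Y s \<omega>)\<^sup>2 \<partial>P)"
        by (simp add: mult.commute)
    qed
  qed simp
  then show "(\<lambda>n. \<integral>\<omega>. W n \<omega> * (\<integral>s. Y s \<omega> * f s \<partial>M) \<partial>P) \<longlonglongrightarrow> 0"
    using W f by (simp add: expectation_times_integral)
qed

end

text \<open>The exchange of integrals is used twice: with the path integral of \<open>Y1\<close> as
  the weight \<open>W\<close>, then with the variable \<open>Y2 r\<close>.\<close>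

lemma covariance_integrals:
  assumes "measurable_l2_field P M Y1" "measurable_l2_field P M Y2" "f1 \<in> l2_funs M" "f2 \<in> l2_funs M"
  shows "(\<integral>\<omega>. (\<integral>s. Y1 s \<omega> * f1 s \<partial>M) * (\<integral>r. Y2 r \<omega> * f2 r \<partial>M) \<partial>P) =
    (\<integral>r. f2 r * (\<integral>s. f1 s * (\<integral>\<omega>. Y2 r \<omega> * Y1 s \<omega> \<partial>P) \<partial>M) \<partial>M)"
proof -
  interpret Y1: measurable_l2_field P M Y1 by fact
  interpret Y2: measurable_l2_field P M Y2 by fact
  have "(\<integral>\<omega>. (\<integral>s. Y1 s \<omega> * f1 s \<partial>M) * (\<integral>r. Y2 r \<omega> * f2 r \<partial>M) \<partial>P) =
    (\<integral>r. f2 r * (\<integral>\<omega>. (\<integral>s. Y1 s \<omega> * f1 s \<partial>M) * Y2 r \<omega> \<partial>P) \<partial>M)"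
    by (rule Y2.expectation_times_integral[OF Y1.integral_l2[OF assms(3)] assms(4)])
  also have "\<dots> = (\<integral>r. f2 r * (\<integral>s. f1 s * (\<integral>\<omega>. Y2 r \<omega> * Y1 s \<omega> \<partial>P) \<partial>M) \<partial>M)"
    using Y1.expectation_times_integral[OF Y2.Y_l2 assms(3)]
    by (intro Bochner_Integration.integral_cong) (auto simp: mult.commute)
  finally show ?thesis .
qed

lemma char_sum_integrals:
  fixes X :: "'s \<Rightarrow> 't \<Rightarrow> 'w \<Rightarrow> real"
  assumes "prob_space P" and gauss: "gaussian_process P (space M \<times> T) (\<lambda>(s, t). X s t)"
    and mean: "\<And>s t. s \<in> space M \<Longrightarrow> t \<in> T \<Longrightarrow> (\<integral>\<omega>. X s t \<omega> \<partial>P) = 0"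
    and field: "\<And>t. t \<in> T \<Longrightarrow> measurable_l2_field P M (\<lambda>s. X s t)"
    and J: "finite J" and t: "\<And>j. j \<in> J \<Longrightarrow> t j \<in> T" and f: "\<And>j. j \<in> J \<Longrightarrow> f j \<in> l2_funs M"
  shows "(CLINT \<omega>|P. iexp (\<Sum>j\<in>J. \<integral>s. X s (t j) \<omega> * f j s \<partial>M)) =
    exp (- (\<Sum>j\<in>J. \<Sum>k\<in>J. \<integral>r. f k r * (\<integral>s. f j s * (\<integral>\<omega>. X r (t k) \<omega> * X s (t j) \<omega> \<partial>P) \<partial>M) \<partial>M) / 2)"
proof -
  interpret P: prob_space P by fact
  define Z where "Z j \<omega> = (\<integral>s. X s (t j) \<omega> * f j s \<partial>M)" for j \<omega>
  \<comment> \<open>The span runs over all pairs of point and time, since the sum mixes several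
    times.\<close>
  let ?G = "rv_span (space M \<times> T) (\<lambda>(s, t). X s t)"
  have base: "X s u \<in> ?G" if "s \<in> space M" "u \<in> T" for s u
    using rv_span_base[of "(s, u)" "space M \<times> T" "\<lambda>(s, t). X s t"] that by simp
  have Zj: "Z j \<in> l2_funs P" "in_weak_span P ?G (Z j)" if "j \<in> J" for j
    using measurable_l2_field.integral_l2[OF field[OF t[OF that]] f[OF that]]
      measurable_l2_field.integral_in_weak_span[OF field[OF t[OF that]] f[OF that] base[OF _ t[OF that]]]
    by (auto simp: Z_def[abs_def])
  have "(CLINT \<omega>|P. iexp (\<Sum>j\<in>J. Z j \<omega>)) = exp (- (\<integral>\<omega>. (\<Sum>j\<in>J. Z j \<omega>)\<^sup>2 \<partial>P) / 2)"
  proof (rule P.char_in_weak_span[where G = ?G])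
    show "?G \<subseteq> l2_funs P" using P.gaussian_rv_l2[OF gaussian_process_span[OF gauss]] by blast
    show "?G \<noteq> {}" unfolding rv_span_def by blast
    show "in_weak_span P ?G (\<lambda>\<omega>. \<Sum>j\<in>J. Z j \<omega>)" using Zj by (intro in_weak_span_sum) auto
    fix g assume g: "g \<in> ?G"
    show "(CLINT \<omega>|P. iexp (g \<omega>)) = exp (- (\<integral>\<omega>. (g \<omega>)\<^sup>2 \<partial>P) / 2)"
      using g mean
      by (intro P.char_gaussian_rv[OF gaussian_process_span[OF gauss] P.expectation_rv_span[OF gauss]]) auto
  qed (rule rv_span_add_scale)
  also have "(\<integral>\<omega>. (\<Sum>j\<in>J. Z j \<omega>)\<^sup>2 \<partial>P) = (\<integral>\<omega>. (\<Sum>j\<in>J. \<Sum>k\<in>J. Z j \<omega> * Z k \<omega>) \<partial>P)"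
    by (simp add: power2_eq_square sum_product)
  also have "\<dots> = (\<Sum>j\<in>J. \<Sum>k\<in>J. \<integral>\<omega>. Z j \<omega> * Z k \<omega> \<partial>P)"
    using Zj l2_funs_mult_integrable[of _ P] by simp
  also have "\<dots> = (\<Sum>j\<in>J. \<Sum>k\<in>J. \<integral>r. f k r * (\<integral>s. f j s * (\<integral>\<omega>. X r (t k) \<omega> * X s (t j) \<omega> \<partial>P) \<partial>M) \<partial>M)"
    unfolding Z_def by (intro sum.cong refl covariance_integrals field t f)
  finally show ?thesis unfolding Z_def .
qed

section \<open>The covariance function\<close>

lemma c_int_nonneg: "0 \<le> c_int d r s"
  unfolding c_int_def set_lebesgue_integral_def by (intro integral_nonneg_AE) auto

text \<open>The integral is cut at 1. Below, the factor \<open>(x + 1) powr (- d s)\<close> is at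
  most 1, leaving the exponent \<open>- d s\<close>; above, \<open>x + 1\<close> is replaced by
  \<open>x\<close>, leaving \<open>- 2 * d s\<close>. The two summands are the integrals of these
  powers.\<close>

lemma c_int_diag_le:
  assumes "1 / 2 < d s" "d s < 1"
  shows "c_int d s s \<le> 1 / (1 - d s) + 1 / (2 * d s - 1)"
proof -
  define \<delta> where "\<delta> = d s"
  have \<delta>: "1 / 2 < \<delta>" "\<delta> < 1" using assms by (simp_all add: \<delta>_def)
  \<comment> \<open>Both pieces contain the point 1, where \<open>g\<close> counts twice; this keeps
    \<open>g\<close> a majorant and does not change its integral.\<close>
  define g where "g x = (if x \<in> {0..1} then x powr (- \<delta>) else 0) + (if x \<in> {1..} then x powr (- 2 * \<delta>) else 0)"
    for x :: real
  define I where "I = 1 / (1 - \<delta>) + 1 / (2 * \<delta> - 1)"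
  have "((\<lambda>x. x powr (- \<delta>)) has_integral (1 / (1 - \<delta>))) {0..1}"
    using has_integral_powr_from_0[of "- \<delta>" 1] \<delta> by simp
  moreover have "((\<lambda>x. x powr (- 2 * \<delta>)) has_integral (1 / (2 * \<delta> - 1))) {1..}"
  proof -
    have "- (1 powr (- 2 * \<delta> + 1)) / (- 2 * \<delta> + 1) = 1 / (2 * \<delta> - 1)"
      using \<delta> by (simp add: field_simps)
    then show ?thesis
      using has_integral_powr_to_inf[of "- 2 * \<delta>" 1] \<delta> by simp
  qed
  ultimately have "(g has_integral I) UNIV"
    unfolding g_def I_def by (intro has_integral_add) (simp_all only: has_integral_restrict_UNIV)
  moreover have g_meas: "g \<in> borel_measurable borel" unfolding g_def by measurable
  moreover have g_nonneg: "0 \<le> g x" for x by (simp add: g_def)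
  ultimately have "integral\<^sup>N lborel g = ennreal I" by (intro nn_integral_has_integral_lborel)
  moreover have "0 \<le> I" using \<delta> by (simp add: I_def)
  ultimately have g: "has_bochner_integral lborel g I"
    using g_meas g_nonneg by (intro has_bochner_integral_nn_integral) auto
  have "c_int d s s = (\<integral>x. indicator {0<..} x * (x powr (- \<delta>) * (x + 1) powr (- \<delta>)) \<partial>lborel)"
    by (simp add: c_int_def set_lebesgue_integral_def \<delta>_def)
  also have "\<dots> \<le> (\<integral>x. g x \<partial>lborel)"
  proof (rule integral_mono')
    show "integrable lborel g" using g by (rule integrable.intros)
    show "0 \<le> g x" for x by (rule g_nonneg)
    fix x :: real
    consider "x \<le> 0" | "0 < x" "x \<le> 1" | "1 < x" by linarith
    then show "indicator {0<..} x * (x powr (- \<delta>) * (x + 1) powr (- \<delta>)) \<le> g x"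
    proof cases
      case 2
      have "(x + 1) powr (- \<delta>) \<le> 1" using powr_mono[of "- \<delta>" 0 "x + 1"] 2 \<delta> by simp
      then have "x powr (- \<delta>) * (x + 1) powr (- \<delta>) \<le> x powr (- \<delta>)"
        by (intro mult_left_le) auto
      also have "\<dots> \<le> g x" using 2 by (simp add: g_def)
      finally show ?thesis using 2 by simp
    next
      case 3
      have "(x + 1) powr (- \<delta>) \<le> x powr (- \<delta>)" using 3 \<delta> by (intro powr_mono2') auto
      then have "x powr (- \<delta>) * (x + 1) powr (- \<delta>) \<le> x powr (- \<delta>) * x powr (- \<delta>)"
        by (intro mult_left_mono) auto
      also have "\<dots> = x powr (- 2 * \<delta>)" by (simp add: powr_add[symmetric])
      finally show ?thesis using 3 by (simp add: g_def)
    qed (simp add: g_nonneg)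
  qed
  also have "\<dots> = I" using g by (rule has_bochner_integral_integral_eq)
  finally show ?thesis by (simp add: I_def \<delta>_def)
qed

text \<open>At equal times the third term of \<open>V_cov\<close> vanishes and the other two
  coincide; their factor 2 cancels against 2 - 2d(s) = 2(1 - d(s)).\<close>

lemma V_cov_diag:
  assumes "d s < 1"
  shows "V_cov d \<sigma> (s, t) (s, t) = \<sigma> s s * c_int d s s * t powr (3 - 2 * d s) / ((1 - d s) * (3 - 2 * d s))"
proof -
  have "V_cov d \<sigma> (s, t) (s, t) =
      \<sigma> s s / (2 * (1 - d s) * (3 - 2 * d s)) * (2 * (c_int d s s * t powr (3 - 2 * d s)))"
    by (simp add: V_cov_def mult_2[symmetric] algebra_simps)
  moreover have "q / (2 * e * g) * (2 * (c * p)) = q * c * p / (e * g)" for q e g c p :: real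
    by simp
  ultimately show ?thesis by (simp only:)
qed

text \<open>The exponent 3 - 2d(s) lies between 1 and 2. Passing from \<open>t\<close> to
  \<open>1 + t\<close>, which is at least 1, makes the bound \<open>(1 + t)\<^sup>2\<close> uniform
  in \<open>s\<close>, and \<open>1 / (3 - 2 * d s)\<close> is at most 1.\<close>

lemma V_cov_diag_bounds:
  assumes "0 \<le> \<sigma> s s" "1 / 2 < d s" "d s < 1" "0 \<le> t"
  shows "0 \<le> V_cov d \<sigma> (s, t) (s, t)"
    and "V_cov d \<sigma> (s, t) (s, t) \<le> (1 + t)\<^sup>2 * (\<sigma> s s / (1 - d s)\<^sup>2 + \<sigma> s s / ((1 - d s) * (2 * d s - 1)))"
proof -
  let ?B = "1 / (1 - d s) + 1 / (2 * d s - 1)"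
  have d: "0 < 1 - d s" "0 < 2 * d s - 1" "1 \<le> 3 - 2 * d s" using assms by auto
  show "0 \<le> V_cov d \<sigma> (s, t) (s, t)"
    unfolding V_cov_diag[where d = d and s = s, OF assms(3)] using assms d c_int_nonneg[of d s s] by (intro divide_nonneg_nonneg mult_nonneg_nonneg) auto
  have "t powr (3 - 2 * d s) \<le> (1 + t) powr (3 - 2 * d s)"
    using assms by (intro powr_mono2) auto
  also have "\<dots> \<le> (1 + t) powr 2" using assms by (intro powr_mono) auto
  finally have t: "t powr (3 - 2 * d s) \<le> (1 + t)\<^sup>2" using assms by simp
  have "V_cov d \<sigma> (s, t) (s, t) = \<sigma> s s / (1 - d s) * (c_int d s s * (t powr (3 - 2 * d s) * (1 / (3 - 2 * d s))))"
    by (simp add: V_cov_diag[where d = d and s = s, OF assms(3)])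
  also have "\<dots> \<le> \<sigma> s s / (1 - d s) * (?B * ((1 + t)\<^sup>2 * 1))"
    using d t assms c_int_nonneg[of d s s] c_int_diag_le[of d s]
    by (intro mult_left_mono mult_mono) auto
  also have "\<dots> = (1 + t)\<^sup>2 * (\<sigma> s s / (1 - d s)\<^sup>2 + \<sigma> s s / ((1 - d s) * (2 * d s - 1)))"
    using d by (simp add: power2_eq_square[of "1 - d s"] algebra_simps)
  finally show "V_cov d \<sigma> (s, t) (s, t) \<le> (1 + t)\<^sup>2 * (\<sigma> s s / (1 - d s)\<^sup>2 + \<sigma> s s / ((1 - d s) * (2 * d s - 1)))" .
qed

text \<open>All three terms carry the power 3 - d(r) - d(s), which splits symmetrically into 3/2 -
  d(r) and 3/2 - d(s). The coefficient \<open>C_sgn\<close> sees only the sign of the time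
  difference, which a positive factor preserves.\<close>

lemma V_cov_scale:
  assumes a: "0 < a" and t: "0 \<le> t" and u: "0 \<le> u"
  shows "V_cov d \<sigma> (r, a * t) (s, a * u) = a powr (3 / 2 - d r) * a powr (3 / 2 - d s) * V_cov d \<sigma> (r, t) (s, u)"
proof -
  let ?p = "3 - (d r + d s)"
  have exp: "a powr (3 / 2 - d r) * a powr (3 / 2 - d s) = a powr ?p"
    by (simp add: powr_add[symmetric] algebra_simps)
  have diff: "a * t - a * u = a * (t - u)" by (simp add: algebra_simps)
  have sgn: "C_sgn d r s (a * (t - u)) = C_sgn d r s (t - u)"
    using a by (simp add: C_sgn_def zero_less_mult_iff mult_less_0_iff)
  have pw: "(a * t) powr ?p = a powr ?p * t powr ?p" "(a * u) powr ?p = a powr ?p * u powr ?p"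
    "\<bar>a * (t - u)\<bar> powr ?p = a powr ?p * \<bar>t - u\<bar> powr ?p"
    using a t u by (simp_all add: powr_mult abs_mult)
  have "q * (c * (A * x) + c' * (A * y) - C * (A * z)) = A * (q * (c * x + c' * y - C * z))"
    for q c c' C A x y z :: real
    by (simp add: algebra_simps)
  then show ?thesis
    unfolding exp V_cov_def prod.case diff sgn pw .
qed

section \<open>Operator self-similarity\<close>

lemma l2_inner_induced:
  assumes "(\<lambda>s. Y s \<omega>) \<in> l2_funs M" "f \<in> borel_measurable M"
  shows "l2_inner M (l2_induced M Y \<omega>) f = (\<integral>s. Y s \<omega> * f s \<partial>M)"
  using assms by (simp add: l2_induced_def l2_inner_class)

text \<open>Inner products with the induced elements and path integrals agree off a null event;
  since \<open>J\<close> is finite, one null event serves all times.\<close>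

lemma char_sum_l2_inner_induced:
  fixes X :: "'s \<Rightarrow> 't \<Rightarrow> 'w \<Rightarrow> real"
  assumes "prob_space P" and sep: "separable_space (l2_topology M)"
    and gauss: "gaussian_process P (space M \<times> T) (\<lambda>(s, t). X s t)"
    and mean: "\<And>s t. s \<in> space M \<Longrightarrow> t \<in> T \<Longrightarrow> (\<integral>\<omega>. X s t \<omega> \<partial>P) = 0"
    and field: "\<And>t. t \<in> T \<Longrightarrow> measurable_l2_field P M (\<lambda>s. X s t)"
    and J: "finite J" and t: "\<And>j. j \<in> J \<Longrightarrow> t j \<in> T" and f: "\<And>j. j \<in> J \<Longrightarrow> f j \<in> l2_funs M"
  shows "(CLINT \<omega>|P. iexp (\<Sum>j\<in>J. l2_inner M (l2_induced M (\<lambda>s. X s (t j)) \<omega>) (f j))) =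
    exp (- (\<Sum>j\<in>J. \<Sum>k\<in>J. \<integral>r. f k r * (\<integral>s. f j s * (\<integral>\<omega>. X r (t k) \<omega> * X s (t j) \<omega> \<partial>P) \<partial>M) \<partial>M) / 2)"
proof -
  define A where "A \<omega> = (\<Sum>j\<in>J. l2_inner M (l2_induced M (\<lambda>s. X s (t j)) \<omega>) (f j))" for \<omega>
  define B where "B \<omega> = (\<Sum>j\<in>J. \<integral>s. X s (t j) \<omega> * f j s \<partial>M)" for \<omega>
  have "(\<lambda>\<omega>. l2_inner M (l2_induced M (\<lambda>s. X s (t j)) \<omega>) (f j)) \<in> borel_measurable P" if "j \<in> J" for j
  proof -
    interpret measurable_l2_field P M "\<lambda>s. X s (t j)" by (rule field[OF t[OF that]])
    show ?thesis
      by (rule measurable_compose[OF measurable_l2_induced[OF _ sep Y] borel_measurable_l2_inner[OF f[OF that]]])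
        (rule M.sigma_finite_measure_axioms)
  qed
  then have [measurable]: "A \<in> borel_measurable P" unfolding A_def by measurable
  have "(\<lambda>\<omega>. \<integral>s. X s (t j) \<omega> * f j s \<partial>M) \<in> borel_measurable P" if "j \<in> J" for j
    using measurable_l2_field.integral_l2[OF field[OF t[OF that]] f[OF that]] by (simp add: l2_funs_def)
  then have [measurable]: "B \<in> borel_measurable P" unfolding B_def by measurable
  have "AE \<omega> in P. \<forall>j\<in>J. (\<lambda>s. X s (t j) \<omega>) \<in> l2_funs M"
    using measurable_l2_field.AE_paths_l2[OF field[OF t]] by (simp add: AE_finite_all[OF J])
  then have "AE \<omega> in P. A \<omega> = B \<omega>"
  proof eventually_elim
    case (elim \<omega>)
    then show ?case
      unfolding A_def B_def using f by (intro sum.cong l2_inner_induced) (auto simp: l2_funs_def)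
  qed
  then have "(CLINT \<omega>|P. iexp (A \<omega>)) = (CLINT \<omega>|P. iexp (B \<omega>))"
    by (intro integral_cong_AE) auto
  then show ?thesis
    unfolding A_def B_def using char_sum_integrals[OF assms(1) gauss mean field J t f] by simp
qed

theorem proposition9:
  fixes M :: "'s measure" and P\<^sub>0 :: "'v measure" and P :: "'w measure"
    and d :: "'s \<Rightarrow> real" and \<epsilon>\<^sub>0 :: "'s \<Rightarrow> 'v \<Rightarrow> real" and X :: "'s \<Rightarrow> real \<Rightarrow> 'w \<Rightarrow> real"
  assumes "sigma_finite_measure M"
    and "separable_space (l2_topology M)"
    and "d \<in> borel_measurable M"
    and "prob_space P\<^sub>0"
    and "(\<lambda>(\<omega>, s). \<epsilon>\<^sub>0 s \<omega>) \<in> borel_measurable (P\<^sub>0 \<Otimes>\<^sub>M M)"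
    and "\<And>s. s \<in> space M \<Longrightarrow> (\<integral>\<omega>. \<epsilon>\<^sub>0 s \<omega> \<partial>P\<^sub>0) = 0"
    and "\<And>s. s \<in> space M \<Longrightarrow> integrable P\<^sub>0 (\<lambda>\<omega>. (\<epsilon>\<^sub>0 s \<omega>)\<^sup>2)"
    and "prob_space P"
    and "gaussian_process P (space M \<times> {0..}) (\<lambda>(s, t). X s t)"
    and "\<And>s t. s \<in> space M \<Longrightarrow> t \<ge> 0 \<Longrightarrow> (\<integral>\<omega>. X s t \<omega> \<partial>P) = 0"
    and "\<And>r s t u. r \<in> space M \<Longrightarrow> s \<in> space M \<Longrightarrow> t \<ge> 0 \<Longrightarrow> u \<ge> 0 \<Longrightarrow>
           (\<integral>\<omega>. X r t \<omega> * X s u \<omega> \<partial>P) = V_cov d (second_moment P\<^sub>0 \<epsilon>\<^sub>0) (r, t) (s, u)"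
    and "\<And>t. t \<ge> 0 \<Longrightarrow> (\<lambda>(\<omega>, s). X s t \<omega>) \<in> borel_measurable (P \<Otimes>\<^sub>M M)"
    and "\<And>s. s \<in> space M \<Longrightarrow> 1 / 2 < d s \<and> d s < 1"
    and "integrable M (\<lambda>v. (\<integral>\<omega>. (\<epsilon>\<^sub>0 v \<omega>)\<^sup>2 \<partial>P\<^sub>0) / (1 - d v)\<^sup>2)"
    and "integrable M (\<lambda>v. (\<integral>\<omega>. (\<epsilon>\<^sub>0 v \<omega>)\<^sup>2 \<partial>P\<^sub>0) / ((1 - d v) * (2 * d v - 1)))"
  shows "(\<forall>t\<ge>0. AE \<omega> in P. (\<lambda>s. X s t \<omega>) \<in> l2_funs M) \<and>
         l2_operator_self_similar P M
           (\<lambda>t. l2_induced M (\<lambda>s. X s t))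
           (\<lambda>a. l2_mult_op M (\<lambda>s. a powr (3 / 2 - d s)))"
proof -
  note sep = assms(2) and gauss = assms(9) and mean = assms(10) and cov = assms(11) and d = assms(13)
  interpret P: prob_space P by fact
  interpret M: sigma_finite_measure M by fact
  define \<sigma> where "\<sigma> = second_moment P\<^sub>0 \<epsilon>\<^sub>0"
  have \<sigma>_diag: "\<sigma> s s = (\<integral>\<omega>. (\<epsilon>\<^sub>0 s \<omega>)\<^sup>2 \<partial>P\<^sub>0)" for s
    by (simp add: \<sigma>_def second_moment_def power2_eq_square)
  have \<sigma>_nonneg: "0 \<le> \<sigma> s s" for s unfolding \<sigma>_diag by simp
  have int: "integrable M (\<lambda>s. \<sigma> s s / (1 - d s)\<^sup>2 + \<sigma> s s / ((1 - d s) * (2 * d s - 1)))"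
    unfolding \<sigma>_diag by (rule Bochner_Integration.integrable_add[OF assms(14,15)])
  have field: "measurable_l2_field P M (\<lambda>s. X s t)" if t: "t \<in> {0..}" for t
  proof
    show meas: "(\<lambda>(\<omega>, s). X s t \<omega>) \<in> borel_measurable (P \<Otimes>\<^sub>M M)" using assms(12) t by simp
    show "X s t \<in> l2_funs P" if "s \<in> space M" for s
      using P.gaussian_rv_l2[OF gaussian_process_span[OF gauss rv_span_base[of "(s, t)"]]] that t by simp
    have var: "(\<integral>\<omega>. (X s t \<omega>)\<^sup>2 \<partial>P) = V_cov d \<sigma> (s, t) (s, t)" if "s \<in> space M" for s
      using cov[OF that that, of t t] t by (simp add: power2_eq_square \<sigma>_def)
    show "integrable M (\<lambda>s. \<integral>\<omega>. (X s t \<omega>)\<^sup>2 \<partial>P)"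
    proof (rule Bochner_Integration.integrable_bound)
      show "integrable M (\<lambda>s. (1 + t)\<^sup>2 * (\<sigma> s s / (1 - d s)\<^sup>2 + \<sigma> s s / ((1 - d s) * (2 * d s - 1))))"
        using int by (rule integrable_mult_right)
      note [measurable] = meas
      have "(\<lambda>(\<omega>, s). (X s t \<omega>)\<^sup>2) \<in> borel_measurable (P \<Otimes>\<^sub>M M)" by measurable
      from measurable_pair_swap[OF this]
      have [measurable]: "(\<lambda>(s, \<omega>). (X s t \<omega>)\<^sup>2) \<in> borel_measurable (M \<Otimes>\<^sub>M P)" by simp
      show "(\<lambda>s. \<integral>\<omega>. (X s t \<omega>)\<^sup>2 \<partial>P) \<in> borel_measurable M" by measurable
      show "AE s in M. norm (\<integral>\<omega>. (X s t \<omega>)\<^sup>2 \<partial>P) \<le>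
          norm ((1 + t)\<^sup>2 * (\<sigma> s s / (1 - d s)\<^sup>2 + \<sigma> s s / ((1 - d s) * (2 * d s - 1))))"
      proof (rule AE_I2)
        fix s assume s: "s \<in> space M"
        then have "1 / 2 < d s" "d s < 1" using d by auto
        from V_cov_diag_bounds[of \<sigma> s d t, OF \<sigma>_nonneg this] t
        show "norm (\<integral>\<omega>. (X s t \<omega>)\<^sup>2 \<partial>P) \<le>
            norm ((1 + t)\<^sup>2 * (\<sigma> s s / (1 - d s)\<^sup>2 + \<sigma> s s / ((1 - d s) * (2 * d s - 1))))"
          unfolding var[OF s] by auto
      qed
    qed
  qed
  have paths: "AE \<omega> in P. (\<lambda>s. X s t \<omega>) \<in> l2_funs M" if "t \<ge> 0" for t
    using measurable_l2_field.AE_paths_l2[OF field, of t] that by simp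
  have rand: "l2_induced M (\<lambda>s. X s t) \<in> measurable P (l2_borel M)" if "t \<ge> 0" for t
    using measurable_l2_induced[OF assms(1) sep assms(12)[OF that]] .
  have mean': "(\<integral>\<omega>. X s t \<omega> \<partial>P) = 0" if "s \<in> space M" "t \<in> {0..}" for s t
    using mean that by simp
  note char_formula = char_sum_l2_inner_induced[OF assms(8) sep gauss mean' field]
  have mult: "l2_bounded_linear M (l2_mult_op M (\<lambda>s. a powr (3 / 2 - d s)))" (is "?bounded")
    and same: "same_fdd P (l2_borel M) {0..} (\<lambda>t. l2_induced M (\<lambda>s. X s (a * t)))
      (\<lambda>t \<omega>. l2_mult_op M (\<lambda>s. a powr (3 / 2 - d s)) (l2_induced M (\<lambda>s. X s t) \<omega>))" (is "?same")
    if a: "a > 0" for a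
  proof -
    define h where "h s = a powr (3 / 2 - d s)" for s
    have h_meas: "h \<in> borel_measurable M" unfolding h_def using assms(3) by measurable
    \<comment> \<open>The exponent lies between 0 and 1, so \<open>max 1 a\<close> is a bound
      uniform in \<open>s\<close> both for \<open>a\<close> below 1 and for \<open>a\<close> above
      1.\<close>
    have h_le: "\<forall>s\<in>space M. \<bar>h s\<bar> \<le> max 1 a"
    proof
      fix s assume "s \<in> space M"
      then have q: "0 \<le> 3 / 2 - d s" "3 / 2 - d s \<le> 1" using d[of s] by auto
      have "h s \<le> max 1 a powr (3 / 2 - d s)" unfolding h_def using a q by (intro powr_mono2) auto
      also have "\<dots> \<le> max 1 a powr 1" using q by (intro powr_mono) auto
      finally show "\<bar>h s\<bar> \<le> max 1 a" by (simp add: h_def)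
    qed
    note hh = h_meas h_le
    show ?bounded
      using l2_bounded_linear_mult_op[OF hh] by (simp add: h_def[abs_def])
    have "same_fdd P (l2_borel M) {0..} (\<lambda>t. l2_induced M (\<lambda>s. X s (a * t)))
      (\<lambda>t \<omega>. l2_mult_op M h (l2_induced M (\<lambda>s. X s t) \<omega>))"
      unfolding same_fdd_def
    proof (intro allI impI, elim conjE)
      fix J :: "real set" assume J: "finite J" "J \<subseteq> {0..}"
      show "distr P (\<Pi>\<^sub>M j\<in>J. l2_borel M) (\<lambda>\<omega>. \<lambda>j\<in>J. l2_induced M (\<lambda>s. X s (a * j)) \<omega>) =
        distr P (\<Pi>\<^sub>M j\<in>J. l2_borel M) (\<lambda>\<omega>. \<lambda>j\<in>J. l2_mult_op M h (l2_induced M (\<lambda>s. X s j) \<omega>))"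
      proof (rule distr_l2_eqI[OF assms(8) sep J(1)])
        show "l2_induced M (\<lambda>s. X s (a * j)) \<in> measurable P (l2_borel M)" if "j \<in> J" for j
          using that J a by (intro rand) auto
        show "(\<lambda>\<omega>. l2_mult_op M h (l2_induced M (\<lambda>s. X s j) \<omega>)) \<in> measurable P (l2_borel M)" if "j \<in> J" for j
          using that J by (intro measurable_l2_mult_op[OF sep hh] rand) auto
        fix f :: "real \<Rightarrow> 's \<Rightarrow> real" assume f: "\<forall>j\<in>J. f j \<in> l2_funs M"
        have hf: "(\<lambda>s. h s * f j s) \<in> l2_funs M" if "j \<in> J" for j
          using f that by (intro l2_funs_mult_bounded[OF hh]) auto
        \<comment> \<open>The scaling factor of the covariance is a product of a function of
          \<open>r\<close> and a function of \<open>s\<close>; each half joins the test function in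
          its own integral.\<close>
        have cov_eq: "(\<integral>r. f k r * (\<integral>s. f j s * (\<integral>\<omega>. X r (a * k) \<omega> * X s (a * j) \<omega> \<partial>P) \<partial>M) \<partial>M) =
            (\<integral>r. h r * f k r * (\<integral>s. h s * f j s * (\<integral>\<omega>. X r k \<omega> * X s j \<omega> \<partial>P) \<partial>M) \<partial>M)"
          if "j \<in> J" "k \<in> J" for j k
        proof -
          have jk: "0 \<le> j" "0 \<le> k" "0 \<le> a * j" "0 \<le> a * k" using J that a by auto
          have sc: "(\<integral>\<omega>. X r (a * k) \<omega> * X s (a * j) \<omega> \<partial>P) = h r * (h s * (\<integral>\<omega>. X r k \<omega> * X s j \<omega> \<partial>P))"
            if "r \<in> space M" "s \<in> space M" for r s
            unfolding cov[OF that jk(4,3)] cov[OF that jk(2,1)] V_cov_scale[OF a jk(2,1)] h_def by (simp add: ac_simps)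
          have inner: "(\<integral>s. f j s * (\<integral>\<omega>. X r (a * k) \<omega> * X s (a * j) \<omega> \<partial>P) \<partial>M) =
              h r * (\<integral>s. h s * f j s * (\<integral>\<omega>. X r k \<omega> * X s j \<omega> \<partial>P) \<partial>M)" if r: "r \<in> space M" for r
          proof -
            have "(\<integral>s. f j s * (\<integral>\<omega>. X r (a * k) \<omega> * X s (a * j) \<omega> \<partial>P) \<partial>M) =
              (\<integral>s. h r * (h s * f j s * (\<integral>\<omega>. X r k \<omega> * X s j \<omega> \<partial>P)) \<partial>M)"
              by (intro Bochner_Integration.integral_cong refl) (subst sc[OF r], assumption, simp only: ac_simps)
            then show ?thesis by simp
          qed
          show ?thesis
            by (intro Bochner_Integration.integral_cong refl) (subst inner, assumption, simp only: ac_simps)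
        qed
        have "(CLINT \<omega>|P. iexp (\<Sum>j\<in>J. l2_inner M (l2_mult_op M h (l2_induced M (\<lambda>s. X s j) \<omega>)) (f j))) =
          (CLINT \<omega>|P. iexp (\<Sum>j\<in>J. l2_inner M (l2_induced M (\<lambda>s. X s j) \<omega>) (\<lambda>s. h s * f j s)))"
        proof (intro Bochner_Integration.integral_cong refl arg_cong[where f = iexp] sum.cong)
          fix \<omega> j assume "\<omega> \<in> space P" "j \<in> J"
          then show "l2_inner M (l2_mult_op M h (l2_induced M (\<lambda>s. X s j) \<omega>)) (f j) =
              l2_inner M (l2_induced M (\<lambda>s. X s j) \<omega>) (\<lambda>s. h s * f j s)"
            using f J measurable_space[OF rand, of j \<omega>]
            by (intro l2_inner_mult_op[OF hh]) (auto simp: space_l2_borel l2_funs_def)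
        qed
        \<comment> \<open>One formula gives both sides: here at the times \<open>j\<close> with the
          test functions \<open>h s * f j s\<close>, next at the times \<open>a * j\<close> with
          \<open>f j\<close>. The two exponents then agree by \<open>cov_eq\<close>.\<close>
        moreover have "(CLINT \<omega>|P. iexp (\<Sum>j\<in>J. l2_inner M (l2_induced M (\<lambda>s. X s j) \<omega>) (\<lambda>s. h s * f j s))) =
          exp (- (\<Sum>j\<in>J. \<Sum>k\<in>J. \<integral>r. h r * f k r * (\<integral>s. h s * f j s * (\<integral>\<omega>. X r k \<omega> * X s j \<omega> \<partial>P) \<partial>M) \<partial>M) / 2)"
          using J hf by (intro char_formula[where t = "\<lambda>j. j"]) auto
        moreover have "(CLINT \<omega>|P. iexp (\<Sum>j\<in>J. l2_inner M (l2_induced M (\<lambda>s. X s (a * j)) \<omega>) (f j))) =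
          exp (- (\<Sum>j\<in>J. \<Sum>k\<in>J. \<integral>r. f k r * (\<integral>s. f j s * (\<integral>\<omega>. X r (a * k) \<omega> * X s (a * j) \<omega> \<partial>P) \<partial>M) \<partial>M) / 2)"
          using J f a by (intro char_formula[where t = "\<lambda>j. a * j"]) auto
        ultimately show "(CLINT \<omega>|P. iexp (\<Sum>j\<in>J. l2_inner M (l2_induced M (\<lambda>s. X s (a * j)) \<omega>) (f j))) =
          (CLINT \<omega>|P. iexp (\<Sum>j\<in>J. l2_inner M (l2_mult_op M h (l2_induced M (\<lambda>s. X s j) \<omega>)) (f j)))"
          using cov_eq by (simp only: cong: sum.cong)
      qed
    qed
    then show ?same by (simp add: h_def[abs_def])
  qed
  show ?thesis
    unfolding l2_operator_self_similar_def using paths rand mult same by blast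
qed

end
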